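(* Let $\Lambda=kQ/I(n;n',n'';V)$, $m=\min(n',n'')$, $d=\dim_kV/(\beta^m)$. If either $d\le 2\le m$, or $d>2$ and $d+\frac{2}{d-2}>m-2$, then $\mathcal D'(\Lambda)\ne 0$ and hence $\dim_k\mathrm{HH}^1(\Lambda)>n-m+c\ge 0$; in particular $\mathrm{HH}^1(\Lambda)\neq 0$.
   Context: $k$ is a field; $Q$ is the quiver with vertices $1,2,3$ and arrows $\alpha\colon 2\to1$, $\beta\colon 2\to 2$, $\gamma\colon 3\to 2$; $kQ$ is generated by pairwise orthogonal idempotents $e_1,e_2,e_3$ (sum $1$) and $\alpha,\beta,\gamma$ with $e_1\alpha=\alpha=\alpha e_2$, $e_2\beta=\beta=\beta e_2$, $e_3\gamma=\gamma=\gamma e_2$, $\gamma\alpha=\beta\alpha=\gamma\beta=0$; for $v=\sum_iv_i\beta^i\in k[\beta]$, $\alpha v\gamma=\sum_iv_i\alpha\beta^i\gamma$. For integers $n\ge 2$, $1\le n',n''\le n$, $m=\min(n',n'')$ and a $k$-subspace $V\subseteq k[\beta]$ containing $(\beta^m)$, $I(n;n',n'';V)$ is the two-sided ideal of $kQ$ generated by $\alpha\beta^{n'}$, $\beta^n$, $\beta^{n''}\gamma$ and all $\alpha v\gamma$, $v\in V$. $\delta=\gcd(n,n',n'')$; $c=1$ if $\delta=0$ in $k$, $c=0$ otherwise. $\mathcal D'(\Lambda)$ is the quotient of $\{\Theta=A+B\frac{d}{d\beta}: A,B\in k[\beta],\ B(0)=0,\ \Theta(V)\subseteq V\}$ (operators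 acting by $v\mapsto Av+Bv'$) by $\{A+B\frac{d}{d\beta}: A\in k+(\beta^m),\ B\in(\beta^m)\}$. $\mathrm{HH}^1(\Lambda)=\mathrm{Der}_k(\Lambda,\Lambda)/\mathrm{Inn}(\Lambda)$. *)

theory Defs
  imports "HOL-Computational_Algebra.Polynomial"
begin

section \<open>The quiver Q and its path algebra kQ\<close>

datatype vert = V1 | V2 | V3
datatype arr = Al | Be | Ga   (* alpha : 2 -> 1, beta : 2 -> 2, gamma : 3 -> 2 *)

fun asrc :: "arr \<Rightarrow> vert" where
  "asrc Al = V2" | "asrc Be = V2" | "asrc Ga = V3"
fun atgt :: "arr \<Rightarrow> vert" where
  "atgt Al = V1" | "atgt Be = V2" | "atgt Ga = V2"

text \<open>A path is a pair (v, [a1,...,ar]) standing for the product a1 a2 ... ar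
  (with e_t a1 = a1, ar e_v = ar); the empty list stands for the idempotent e_v.
  Multiplication convention as in the paper: e1 alpha = alpha = alpha e2, so a word
  a1 a2 is nonzero iff source(a1) = target(a2).\<close>

type_synonym path = "vert \<times> arr list"

fun chain :: "arr list \<Rightarrow> bool" where
  "chain [] = True"
| "chain [a] = True"
| "chain (a # b # ws) = (asrc a = atgt b \<and> chain (b # ws))"

definition valid_path :: "path \<Rightarrow> bool" where
  "valid_path p = (chain (snd p) \<and> (snd p \<noteq> [] \<longrightarrow> asrc (last (snd p)) = fst p))"

definition psrc :: "path \<Rightarrow> vert" where
  "psrc p = fst p"

definition ptgt :: "path \<Rightarrow> vert" where
  "ptgt p = (if snd p = [] then fst p else atgt (hd (snd p)))"

text \<open>Elements of kQ: finitely supported k-valued functions on valid paths.\<close>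
type_synonym 'a kqel = "path \<Rightarrow> 'a"

definition kQ :: "('a::field) kqel set" where
  "kQ = {f. finite {p. f p \<noteq> 0} \<and> (\<forall>p. f p \<noteq> 0 \<longrightarrow> valid_path p)}"

definition kq_add :: "('a::field) kqel \<Rightarrow> 'a kqel \<Rightarrow> 'a kqel" where
  "kq_add f g = (\<lambda>p. f p + g p)"

definition kq_diff :: "('a::field) kqel \<Rightarrow> 'a kqel \<Rightarrow> 'a kqel" where
  "kq_diff f g = (\<lambda>p. f p - g p)"

definition kq_smult :: "'a::field \<Rightarrow> 'a kqel \<Rightarrow> 'a kqel" where
  "kq_smult c f = (\<lambda>p. c * f p)"

definition kq_mult :: "('a::field) kqel \<Rightarrow> 'a kqel \<Rightarrow> 'a kqel" where
  "kq_mult f g = (\<lambda>p. \<Sum>q\<in>{q. f q \<noteq> 0}. \<Sum>r\<in>{r. g r \<noteq> 0}.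
      (if psrc q = ptgt r \<and> (fst r, snd q @ snd r) = p then f q * g r else 0))"

definition kq_path :: "path \<Rightarrow> ('a::field) kqel" where
  "kq_path p = (\<lambda>q. if q = p then 1 else 0)"

definition alpha :: "('a::field) kqel" where "alpha = kq_path (V2, [Al])"
definition gamma :: "('a::field) kqel" where "gamma = kq_path (V3, [Ga])"
definition bpow :: "nat \<Rightarrow> ('a::field) kqel" where
  "bpow i = kq_path (V2, replicate i Be)"   (* beta^0 = e2 *)

text \<open>The element v(beta) = sum_i v_i beta^i of kQ for v in k[beta].\<close>
definition embed :: "('a::field) poly \<Rightarrow> 'a kqel" where
  "embed v = (\<lambda>p. if fst p = V2 \<and> (\<forall>a\<in>set (snd p). a = Be)
                  then coeff v (length (snd p)) else 0)"

text \<open>Two-sided ideal of kQ generated by a set S.\<close>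
inductive_set kq_ideal :: "('a::field) kqel set \<Rightarrow> 'a kqel set" for S where
  gen: "s \<in> S \<Longrightarrow> s \<in> kq_ideal S"
| zero: "(\<lambda>p. 0) \<in> kq_ideal S"
| add: "x \<in> kq_ideal S \<Longrightarrow> y \<in> kq_ideal S \<Longrightarrow> kq_add x y \<in> kq_ideal S"
| lmult: "a \<in> kQ \<Longrightarrow> x \<in> kq_ideal S \<Longrightarrow> kq_mult a x \<in> kq_ideal S"
| rmult: "a \<in> kQ \<Longrightarrow> x \<in> kq_ideal S \<Longrightarrow> kq_mult x a \<in> kq_ideal S"

text \<open>I(n;n',n'';V).\<close>
definition I_ideal :: "nat \<Rightarrow> nat \<Rightarrow> nat \<Rightarrow> ('a::field) poly set \<Rightarrow> 'a kqel set" where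
  "I_ideal n n' n'' V = kq_ideal
     ({kq_mult alpha (bpow n'), bpow n, kq_mult (bpow n'') gamma}
      \<union> {kq_mult alpha (kq_mult (embed v) gamma) | v. v \<in> V})"

section \<open>Derivations of Lambda = kQ/I, represented through lifts to kQ\<close>

text \<open>A k-linear derivation of kQ/I is given by a map D on kQ which is well defined
  modulo I, k-linear modulo I and satisfies the Leibniz rule modulo I.\<close>
definition is_lam_der :: "('a::field) kqel set \<Rightarrow> ('a kqel \<Rightarrow> 'a kqel) \<Rightarrow> bool" where
  "is_lam_der I D \<longleftrightarrow>
     (\<forall>x\<in>kQ. D x \<in> kQ) \<and>
     (\<forall>x\<in>kQ. \<forall>y\<in>kQ. kq_diff x y \<in> I \<longrightarrow> kq_diff (D x) (D y) \<in> I) \<and>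
     (\<forall>x\<in>kQ. \<forall>y\<in>kQ. kq_diff (D (kq_add x y)) (kq_add (D x) (D y)) \<in> I) \<and>
     (\<forall>c. \<forall>x\<in>kQ. kq_diff (D (kq_smult c x)) (kq_smult c (D x)) \<in> I) \<and>
     (\<forall>x\<in>kQ. \<forall>y\<in>kQ. kq_diff (D (kq_mult x y))
                               (kq_add (kq_mult (D x) y) (kq_mult x (D y))) \<in> I)"

text \<open>Inner derivation [a,-] of kQ/I (equality modulo I).\<close>
definition is_lam_inner :: "('a::field) kqel set \<Rightarrow> ('a kqel \<Rightarrow> 'a kqel) \<Rightarrow> bool" where
  "is_lam_inner I D \<longleftrightarrow>
     (\<exists>a\<in>kQ. \<forall>x\<in>kQ. kq_diff (D x) (kq_diff (kq_mult a x) (kq_mult x a)) \<in> I)"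

text \<open>dim_k HH^1(kQ/I) > N: there are N+1 derivations linearly independent modulo Inn.\<close>
definition hh1_dim_gt :: "('a::field) kqel set \<Rightarrow> nat \<Rightarrow> bool" where
  "hh1_dim_gt I N \<longleftrightarrow>
     (\<exists>Ds :: nat \<Rightarrow> ('a kqel \<Rightarrow> 'a kqel).
        (\<forall>i\<le>N. is_lam_der I (Ds i)) \<and>
        (\<forall>cs :: nat \<Rightarrow> 'a. is_lam_inner I (\<lambda>x p. \<Sum>i\<le>N. cs i * Ds i x p)
                             \<longrightarrow> (\<forall>i\<le>N. cs i = 0)))"

text \<open>HH^1(kQ/I) \<noteq> 0.\<close>
definition hh1_nonzero :: "('a::field) kqel set \<Rightarrow> bool" where
  "hh1_nonzero I \<longleftrightarrow> (\<exists>D. is_lam_der I D \<and> \<not> is_lam_inner I D)"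

section \<open>Data in k[beta]\<close>

definition poly_subspace :: "('a::field) poly set \<Rightarrow> bool" where
  "poly_subspace V \<longleftrightarrow> 0 \<in> V \<and> (\<forall>x\<in>V. \<forall>y\<in>V. x + y \<in> V) \<and> (\<forall>c. \<forall>x\<in>V. smult c x \<in> V)"

text \<open>r elements of V linearly independent modulo the ideal (beta^m).\<close>
definition indep_mod :: "('a::field) poly set \<Rightarrow> nat \<Rightarrow> nat \<Rightarrow> bool" where
  "indep_mod V m r \<longleftrightarrow> (\<exists>ps. length ps = r \<and> set ps \<subseteq> V \<and>
     (\<forall>cs::'a list. length cs = r \<longrightarrow> monom 1 m dvd (\<Sum>i<r. smult (cs ! i) (ps ! i))
                       \<longrightarrow> (\<forall>i<r. cs ! i = 0)))"

text \<open>dim_k V/(beta^m).\<close>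
definition quot_dim :: "('a::field) poly set \<Rightarrow> nat \<Rightarrow> nat" where
  "quot_dim V m = (GREATEST r. indep_mod V m r)"

text \<open>D'(Lambda) \<noteq> 0: some Theta = A + B d/dbeta with B(0)=0, Theta(V) \<subseteq> V, is not in
  the subspace {A + B d/dbeta : A \<in> k + (beta^m), B \<in> (beta^m)}.\<close>
definition Dprime_nonzero :: "('a::field) poly set \<Rightarrow> nat \<Rightarrow> bool" where
  "Dprime_nonzero V m \<longleftrightarrow> (\<exists>A B :: 'a poly. coeff B 0 = 0 \<and>
      (\<forall>v\<in>V. A * v + B * pderiv v \<in> V) \<and>
      \<not> ((\<exists>c. monom 1 m dvd (A - [:c:])) \<and> monom 1 m dvd B))"

end

theory Submission
  imports Defs "HOL-Library.Product_Plus"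
begin

(* Write an element of kQ as a1 e1 + a3 e3 + R(\<beta>) + \<alpha> M(\<beta>) + P(\<beta>) \<gamma> + \<alpha> N(\<beta>) \<gamma>.
   In these coordinates I consists of the elements with a1 = a3 = 0, \<beta>^n | R, \<beta>^n' | M,
   \<beta>^n'' | P and N \<in> V.  An operator \<Theta> = A + F d/d\<beta> with \<Theta>(V) \<subseteq> V and \<delta> F(0) = 0 yields
   the derivation e_i, \<gamma> \<mapsto> 0, \<beta> \<mapsto> F, \<alpha> \<mapsto> \<alpha> A of \<Lambda>, and if A(0) = 0, deg A < m and
   deg F < n it is inner only for \<Theta> = 0: commutators cannot produce F from \<beta>, nor the
   coefficients 1 \<le> j < m of A from \<alpha> and \<gamma> simultaneously.
   With respect to a basis of V/(\<beta>^m) in echelon form, \<Theta>(V) \<subseteq> V becomes d(m - d) linear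
   conditions on the space of \<Theta> with A \<in> span(\<beta>, ..., \<beta>^(m-1)) and
   F \<in> span(\<beta>^(1-c), ..., \<beta>^(m-1)), of dimension 2m - 2 + c.  The hypothesis on d is exactly
   d(m - d) + 3 \<le> 2m, so c + 1 independent solutions remain (for c = 0 a nonzero one lies in
   D'(\<Lambda>)); together with \<Theta> = \<beta>^j d/d\<beta> for m \<le> j < n they give n - m + c + 1 derivations
   that are independent modulo inner ones. *)

section \<open>Independent families and linear forms\<close>

definition independent_family ::
    "('a::field \<Rightarrow> 'b::ab_group_add \<Rightarrow> 'b) \<Rightarrow> ('i \<Rightarrow> 'b) \<Rightarrow> 'i set \<Rightarrow> bool" where
  "independent_family scale w I \<longleftrightarrow>
     (\<forall>u. (\<Sum>i\<in>I. scale (u i) (w i)) = 0 \<longrightarrow> (\<forall>i\<in>I. u i = 0))"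

context vector_space
begin

lemma independent_familyD:
  "independent_family (*s) w I \<Longrightarrow> (\<Sum>i\<in>I. u i *s w i) = 0 \<Longrightarrow> i \<in> I \<Longrightarrow> u i = 0"
  by (auto simp: independent_family_def)

lemma independent_family_subset:
  assumes indep: "independent_family (*s) w I" and "J \<subseteq> I" "finite I"
  shows "independent_family (*s) w J"
  unfolding independent_family_def
proof (intro allI impI ballI)
  fix u i assume sum0: "(\<Sum>i\<in>J. u i *s w i) = 0" and i: "i \<in> J"
  let ?u = "\<lambda>i. if i \<in> J then u i else 0"
  have "(\<Sum>i\<in>I. ?u i *s w i) = (\<Sum>i\<in>J. ?u i *s w i)"
    using assms(2,3) by (intro sum.mono_neutral_right) auto
  also have "\<dots> = 0" using sum0 by simp
  finally have "?u i = 0" using i \<open>J \<subseteq> I\<close> by (intro independent_familyD[OF indep]) auto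
  then show "u i = 0" using i by simp
qed

lemma independent_family_reindex:
  assumes indep: "independent_family (*s) w (f ` J)" and inj: "inj_on f J"
  shows "independent_family (*s) (w \<circ> f) J"
  unfolding independent_family_def
proof (intro allI impI ballI)
  fix u j assume sum0: "(\<Sum>j\<in>J. u j *s (w \<circ> f) j) = 0" and j: "j \<in> J"
  let ?u = "u \<circ> the_inv_into J f"
  have "(\<Sum>i\<in>f ` J. ?u i *s w i) = (\<Sum>j\<in>J. u j *s (w \<circ> f) j)"
    using inj by (simp add: sum.reindex the_inv_into_f_f)
  then have "?u (f j) = 0" using indep sum0 j by (auto intro: independent_familyD)
  then show "u j = 0" using inj j by (simp add: the_inv_into_f_f)
qed

lemma independent_family_nonzero:
  assumes "independent_family (*s) w I" "finite I" "i \<in> I"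
  shows "w i \<noteq> 0"
proof
  assume "w i = 0"
  then have "(\<Sum>k\<in>I. (if k = i then 1 else 0) *s w k) = 0"
    using assms(2,3) by (simp add: if_distrib[of "\<lambda>c. c *s _"] cong: if_cong)
  then show False using independent_familyD[OF assms(1) _ assms(3)] by fastforce
qed

lemma linear_functionalI:
  assumes "\<And>x y. L (x + y) = L x + L y" and "\<And>c x. L (c *s x) = c * L x"
  shows "Vector_Spaces.linear scale (*) L"
proof -
  have "vector_space ((*) :: 'a \<Rightarrow> 'a \<Rightarrow> 'a)"
    by unfold_locales (simp_all add: algebra_simps)
  then show ?thesis using assms vector_space_axioms by (simp add: Vector_Spaces.linear_iff)
qed

lemma subspace_common_kernel:
  assumes "\<forall>L\<in>Ls. Vector_Spaces.linear scale (*) L"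
  shows "subspace {x. \<forall>L\<in>Ls. L x = 0}"
proof -
  have "{x. \<forall>L\<in>Ls. L x = 0} = (\<Inter>L\<in>Ls. {x. L x = 0})" by auto
  moreover have "subspace {x. L x = 0}" if "L \<in> Ls" for L
    using assms that module_hom.subspace_kernel Vector_Spaces.module_hom_iff_linear by blast
  ultimately show ?thesis by (simp add: subspace_Int)
qed

lemma independent_family_in_kernel:
  assumes "finite I" and indep: "independent_family (*s) w I" and "subspace S" "w ` I \<subseteq> S"
    and lin: "Vector_Spaces.linear scale (*) L"
  obtains I' w' where "I' \<subseteq> I" "card I \<le> Suc (card I')" "independent_family (*s) w' I'"
    "w' ` I' \<subseteq> S \<inter> {x. L x = 0}"
proof (cases "\<forall>i\<in>I. L (w i) = 0")
  case True
  show ?thesis by (rule that[of I w]) (use True indep assms(4) in auto)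
next
  case False
  then obtain j where j: "j \<in> I" "L (w j) \<noteq> 0" by blast
  have L_add: "L (x + y) = L x + L y" and L_scale: "L (c *s x) = c * L x" for x y c
    using lin by (auto simp: Vector_Spaces.linear_iff)
  have L_diff: "L (x - y) = L x - L y" for x y
    using L_add[of "x - y" y] by simp
  define w' where "w' i = w i - (L (w i) / L (w j)) *s w j" for i
  have "w' i \<in> S" if "i \<in> I" for i
    using that j assms(3,4) unfolding w'_def by (blast intro: subspace_diff subspace_scale)
  moreover have "L (w' i) = 0" for i
    using j by (simp add: w'_def L_diff L_scale)
  moreover have "independent_family (*s) w' (I - {j})"
    unfolding independent_family_def
  proof (intro allI impI)
    fix u assume sum0: "(\<Sum>i\<in>I - {j}. u i *s w' i) = 0"
    define u' where "u' = u(j := - (\<Sum>i\<in>I - {j}. u i * (L (w i) / L (w j))))"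
    have "(\<Sum>i\<in>I. u' i *s w i) = (\<Sum>i\<in>I - {j}. u i *s w' i)"
      using \<open>finite I\<close> j
      by (simp add: u'_def w'_def sum.remove[of I j] scale_right_diff_distrib scale_sum_left
          sum_subtractf)
    then have "\<forall>i\<in>I. u' i = 0" using sum0 indep by (auto intro: independent_familyD)
    then show "\<forall>i\<in>I - {j}. u i = 0" by (metis DiffE fun_upd_other singletonI u'_def)
  qed
  moreover have "card I \<le> Suc (card (I - {j}))"
    using \<open>finite I\<close> j by (simp add: card_Diff_singleton)
  ultimately show ?thesis using that[of "I - {j}" w'] by blast
qed

lemma independent_family_in_kernels_subset:
  assumes "finite Ls" "finite I" "independent_family (*s) w I" "subspace S" "w ` I \<subseteq> S"
    and "\<forall>L\<in>Ls. Vector_Spaces.linear scale (*) L"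
  shows "\<exists>I' w'. I' \<subseteq> I \<and> card I \<le> card I' + card Ls \<and> independent_family (*s) w' I' \<and>
           w' ` I' \<subseteq> S \<inter> {x. \<forall>L\<in>Ls. L x = 0}"
  using assms(1,6)
proof (induction Ls rule: finite_induct)
  case empty
  then show ?case using assms(3,5) by auto
next
  case (insert L Ls)
  then obtain I1 w1 where I1: "I1 \<subseteq> I" "card I \<le> card I1 + card Ls" "independent_family (*s) w1 I1"
    "w1 ` I1 \<subseteq> S \<inter> {x. \<forall>L\<in>Ls. L x = 0}"
    by auto
  have "finite I1" using I1(1) assms(2) finite_subset by blast
  moreover have "subspace (S \<inter> {x. \<forall>L\<in>Ls. L x = 0})"
    using insert.prems assms(4) by (simp add: subspace_inter subspace_common_kernel)
  ultimately obtain I' w' where "I' \<subseteq> I1" "card I1 \<le> Suc (card I')" "independent_family (*s) w' I'"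
      "w' ` I' \<subseteq> S \<inter> {x. \<forall>L\<in>Ls. L x = 0} \<inter> {x. L x = 0}"
    using independent_family_in_kernel[OF _ I1(3) _ I1(4)] insert.prems by blast
  then show ?case using I1 insert.hyps by (intro exI[of _ I'] exI[of _ w']) auto
qed

lemma independent_family_in_kernels:
  assumes "finite Ls" "finite I" "independent_family (*s) w I" "subspace S" "w ` I \<subseteq> S"
    and "\<forall>L\<in>Ls. Vector_Spaces.linear scale (*) L" and "r + card Ls \<le> card I"
  obtains w' where "independent_family (*s) w' {..<r}" "w' ` {..<r} \<subseteq> S \<inter> {x. \<forall>L\<in>Ls. L x = 0}"
proof -
  obtain I' w' where I': "I' \<subseteq> I" "card I \<le> card I' + card Ls" "independent_family (*s) w' I'"
    "w' ` I' \<subseteq> S \<inter> {x. \<forall>L\<in>Ls. L x = 0}"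
    using independent_family_in_kernels_subset[OF assms(1-6)] by blast
  have "finite I'" using I'(1) assms(2) finite_subset by blast
  moreover have "card {..<r} \<le> card I'" using I'(2) assms(7) by simp
  ultimately obtain f where f: "f ` {..<r} \<subseteq> I'" "inj_on f {..<r}"
    using card_le_inj[of "{..<r}" I'] by blast
  have "independent_family (*s) (w' \<circ> f) {..<r}"
    using independent_family_subset[OF I'(3) f(1) \<open>finite I'\<close>] f(2)
    by (rule independent_family_reindex)
  moreover have "(w' \<circ> f) ` {..<r} \<subseteq> S \<inter> {x. \<forall>L\<in>Ls. L x = 0}" using f(1) I'(4) by auto
  ultimately show ?thesis by (rule that)
qed

lemma nonzero_in_kernels:
  assumes "finite Ls" "finite I" "independent_family (*s) w I" "subspace S" "w ` I \<subseteq> S"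
    and "\<forall>L\<in>Ls. Vector_Spaces.linear scale (*) L" and "card Ls < card I"
  obtains x where "x \<in> S" "x \<noteq> 0" "\<forall>L\<in>Ls. L x = 0"
proof -
  obtain w' where "independent_family (*s) w' {..<1::nat}"
    and "w' ` {..<1} \<subseteq> S \<inter> {x. \<forall>L\<in>Ls. L x = 0}"
    by (rule independent_family_in_kernels[OF assms(1-6), where r = 1]) (use assms(7) in auto)
  then show ?thesis using that[of "w' 0"] by (auto dest: independent_family_nonzero)
qed

end

section \<open>Paths of the quiver\<close>

lemma chain_Cons: "chain (a # w) \<longleftrightarrow> chain w \<and> (w \<noteq> [] \<longrightarrow> asrc a = atgt (hd w))"
  by (cases w) auto

lemma chain_append:
  "chain (xs @ ys) \<longleftrightarrow> chain xs \<and> chain ys \<and> (xs \<noteq> [] \<longrightarrow> ys \<noteq> [] \<longrightarrow> asrc (last xs) = atgt (hd ys))"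
  by (induction xs) (auto simp: chain_Cons)

lemma chain_replicate_Be: "chain (replicate k Be @ w) \<longleftrightarrow> chain w \<and> (k \<noteq> 0 \<longrightarrow> w \<noteq> [] \<longrightarrow> atgt (hd w) = V2)"
  by (induction k) (auto simp: chain_Cons hd_append)

lemma chain_replicate: "chain (replicate k Be)"
  using chain_replicate_Be[of k "[]"] by simp

lemma chain_word_shape:
  assumes "chain w"
  shows "\<exists>a k g. w = (if a then [Al] else []) @ replicate k Be @ (if g then [Ga] else [])"
  using assms
proof (induction w rule: chain.induct)
  case 1
  show ?case by (intro exI[of _ False] exI[of _ 0]) simp
next
  case (2 a)
  show ?case
  proof (cases a)
    case Al then show ?thesis by (intro exI[of _ True] exI[of _ 0] exI[of _ False]) simp
  next
    case Be then show ?thesis by (intro exI[of _ False] exI[of _ 1] exI[of _ False]) simp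
  next
    case Ga then show ?thesis by (intro exI[of _ False] exI[of _ 0] exI[of _ True]) simp
  qed
next
  case (3 a b ws)
  then obtain a' k g where e: "b # ws = (if a' then [Al] else []) @ replicate k Be @ (if g then [Ga] else [])"
    and src: "asrc a = atgt b" by auto
  have "\<not> a'"
    using e src by (cases a; cases a') auto
  show ?case
  proof (cases a)
    case Al
    then show ?thesis using e \<open>\<not> a'\<close> by (intro exI[of _ True] exI[of _ k] exI[of _ g]) simp
  next
    case Be
    then show ?thesis using e \<open>\<not> a'\<close> by (intro exI[of _ False] exI[of _ "Suc k"] exI[of _ g]) simp
  next
    case Ga
    then show ?thesis using src by (cases b) auto
  qed
qed

lemma valid_path_simps[simp]:
  "valid_path (v, [])"
  "valid_path (V2, replicate k Be)"
  "valid_path (V2, Al # replicate k Be)"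
  "valid_path (V3, replicate k Be @ [Ga])"
  "valid_path (V3, Al # replicate k Be @ [Ga])"
  "valid_path (V2, [Al])" "valid_path (V3, [Ga])" "valid_path (V3, [Al, Ga])"
  by (auto simp: valid_path_def chain_Cons chain_replicate chain_replicate_Be hd_append)

lemma replicate_Be_neq_Al_Cons[simp]:
  "replicate k Be \<noteq> Al # w" "Al # w \<noteq> replicate k Be"
  by (cases k; simp)+

lemma valid_path_cases:
  assumes "valid_path p"
  obtains "p = (V1, [])" | "p = (V3, [])"
    | k where "p = (V2, replicate k Be)" | k where "p = (V2, Al # replicate k Be)"
    | k where "p = (V3, replicate k Be @ [Ga])" | k where "p = (V3, Al # replicate k Be @ [Ga])"
proof -
  obtain v w where p: "p = (v, w)" by force
  have "chain w" and last_w: "w \<noteq> [] \<Longrightarrow> asrc (last w) = v"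
    using assms p by (auto simp: valid_path_def)
  then obtain a k g where w: "w = (if a then [Al] else []) @ replicate k Be @ (if g then [Ga] else [])"
    using chain_word_shape by blast
  consider "w = []" | "g" | "\<not> g" "k = 0" "w \<noteq> []" | k' where "\<not> g" "k = Suc k'"
    by (cases k) auto
  then show ?thesis
  proof cases
    case 1
    then show ?thesis using p that(1) that(2) that(3)[of 0] by (cases v) auto
  next
    case 2
    then show ?thesis using p w last_w that(5,6) by (cases a) auto
  next
    case 3
    then show ?thesis using p w last_w that(4)[of 0] by (cases a) auto
  next
    case 4
    then have "v = V2" using w last_w by (auto simp: last_append last_replicate split: if_splits)
    then show ?thesis using p w 4 that(3)[of k] that(4)[of k] by (cases a) auto
  qed
qed

section \<open>Coordinates on kQ\<close>

text \<open>\<open>kq_elem a1 a3 R M P N\<close> is \<open>a1 e1 + a3 e3 + R(\<beta>) + \<alpha> M(\<beta>) + P(\<beta>) \<gamma> + \<alpha> N(\<beta>) \<gamma>\<close>;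
  \<open>R(\<beta>)\<close> includes the multiple \<open>coeff R 0\<close> of \<open>e2\<close>.\<close>
definition kq_elem :: "'a::field \<Rightarrow> 'a \<Rightarrow> 'a poly \<Rightarrow> 'a poly \<Rightarrow> 'a poly \<Rightarrow> 'a poly \<Rightarrow> 'a kqel" where
  "kq_elem a1 a3 R M P N = (\<lambda>(v, w).
     if w = [] then (case v of V1 \<Rightarrow> a1 | V2 \<Rightarrow> coeff R 0 | V3 \<Rightarrow> a3)
     else if v = V2 \<and> w = replicate (length w) Be then coeff R (length w)
     else if v = V2 \<and> w = Al # replicate (length w - 1) Be then coeff M (length w - 1)
     else if v = V3 \<and> w = replicate (length w - 1) Be @ [Ga] then coeff P (length w - 1)
     else if v = V3 \<and> w = Al # replicate (length w - 2) Be @ [Ga] then coeff N (length w - 2)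
     else 0)"

lemma kq_elem_apply[simp]:
  "kq_elem a1 a3 R M P N (V1, []) = a1"
  "kq_elem a1 a3 R M P N (V3, []) = a3"
  "kq_elem a1 a3 R M P N (V2, replicate k Be) = coeff R k"
  "kq_elem a1 a3 R M P N (V2, Al # replicate k Be) = coeff M k"
  "kq_elem a1 a3 R M P N (V3, replicate k Be @ [Ga]) = coeff P k"
  "kq_elem a1 a3 R M P N (V3, Al # replicate k Be @ [Ga]) = coeff N k"
  "kq_elem a1 a3 R M P N (V2, [Al]) = coeff M 0"
  "kq_elem a1 a3 R M P N (V3, [Ga]) = coeff P 0"
  "kq_elem a1 a3 R M P N (V3, [Al, Ga]) = coeff N 0"
  by (cases k; simp add: kq_elem_def)+

lemma kq_elem_valid: "kq_elem a1 a3 R M P N p \<noteq> 0 \<Longrightarrow> valid_path p"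
  by (cases p) (simp add: kq_elem_def split: if_split_asm; metis valid_path_simps)

lemma kq_elem_support:
  fixes R M P N :: "'a::field poly"
  defines "D \<equiv> degree R + degree M + degree P + degree N"
  shows "{p. kq_elem a1 a3 R M P N p \<noteq> 0} \<subseteq> {(V1, []), (V3, [])} \<union>
    (\<Union>k\<le>D. {(V2, replicate k Be), (V2, Al # replicate k Be),
               (V3, replicate k Be @ [Ga]), (V3, Al # replicate k Be @ [Ga])})"
proof
  fix p assume "p \<in> {p. kq_elem a1 a3 R M P N p \<noteq> 0}"
  then have nz: "kq_elem a1 a3 R M P N p \<noteq> 0" by simp
  have "k \<le> D" if "coeff R k \<noteq> 0 \<or> coeff M k \<noteq> 0 \<or> coeff P k \<noteq> 0 \<or> coeff N k \<noteq> 0" for k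
    using that by (auto dest!: le_degree simp: D_def)
  with kq_elem_valid[OF nz] nz show "p \<in> {(V1, []), (V3, [])} \<union>
    (\<Union>k\<le>D. {(V2, replicate k Be), (V2, Al # replicate k Be),
               (V3, replicate k Be @ [Ga]), (V3, Al # replicate k Be @ [Ga])})"
    by (cases rule: valid_path_cases) auto
qed

lemma finite_kq_elem_support: "finite {p. kq_elem a1 a3 R M P N p \<noteq> 0}"
  using finite_subset[OF kq_elem_support] by auto

lemma kq_elem_in_kQ[simp]: "kq_elem a1 a3 R M P N \<in> kQ"
  unfolding kQ_def using finite_kq_elem_support kq_elem_valid by auto

definition e1_part :: "'a::field kqel \<Rightarrow> 'a" where
  "e1_part f = f (V1, [])"
definition e3_part :: "'a::field kqel \<Rightarrow> 'a" where
  "e3_part f = f (V3, [])"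
definition beta_part :: "'a::field kqel \<Rightarrow> 'a poly" where
  "beta_part f = Abs_poly (\<lambda>k. f (V2, replicate k Be))"
definition alpha_part :: "'a::field kqel \<Rightarrow> 'a poly" where
  "alpha_part f = Abs_poly (\<lambda>k. f (V2, Al # replicate k Be))"
definition gamma_part :: "'a::field kqel \<Rightarrow> 'a poly" where
  "gamma_part f = Abs_poly (\<lambda>k. f (V3, replicate k Be @ [Ga]))"
definition alpha_gamma_part :: "'a::field kqel \<Rightarrow> 'a poly" where
  "alpha_gamma_part f = Abs_poly (\<lambda>k. f (V3, Al # replicate k Be @ [Ga]))"

lemma coeff_Abs_poly_comp:
  assumes "finite {p. f p \<noteq> 0}" "inj h"
  shows "coeff (Abs_poly (\<lambda>k. f (h k))) = (\<lambda>k. f (h k))"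
proof -
  have "finite (h -` {p. f p \<noteq> 0})" using assms by (intro finite_vimageI) auto
  then have "\<forall>\<^sub>\<infinity>k. f (h k) = 0" by (simp add: MOST_iff_cofinite vimage_def)
  then show ?thesis by (simp add: Abs_poly_inverse)
qed

lemma coeff_parts:
  assumes "f \<in> kQ"
  shows "coeff (beta_part f) k = f (V2, replicate k Be)"
    "coeff (alpha_part f) k = f (V2, Al # replicate k Be)"
    "coeff (gamma_part f) k = f (V3, replicate k Be @ [Ga])"
    "coeff (alpha_gamma_part f) k = f (V3, Al # replicate k Be @ [Ga])"
proof -
  have fin: "finite {p. f p \<noteq> 0}" using assms by (simp add: kQ_def)
  have "inj (\<lambda>k. (V2, replicate k Be))" "inj (\<lambda>k. (V2, Al # replicate k Be))"
    "inj (\<lambda>k. (V3, replicate k Be @ [Ga]))" "inj (\<lambda>k. (V3, Al # replicate k Be @ [Ga]))"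
    by (auto intro!: injI dest: arg_cong[of _ _ length])
  with coeff_Abs_poly_comp[OF fin] show
    "coeff (beta_part f) k = f (V2, replicate k Be)"
    "coeff (alpha_part f) k = f (V2, Al # replicate k Be)"
    "coeff (gamma_part f) k = f (V3, replicate k Be @ [Ga])"
    "coeff (alpha_gamma_part f) k = f (V3, Al # replicate k Be @ [Ga])"
    by (simp_all add: beta_part_def alpha_part_def gamma_part_def alpha_gamma_part_def)
qed

lemma parts_kq_elem[simp]:
  "e1_part (kq_elem a1 a3 R M P N) = a1" "e3_part (kq_elem a1 a3 R M P N) = a3"
  "beta_part (kq_elem a1 a3 R M P N) = R" "alpha_part (kq_elem a1 a3 R M P N) = M"
  "gamma_part (kq_elem a1 a3 R M P N) = P" "alpha_gamma_part (kq_elem a1 a3 R M P N) = N"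
  by (simp_all add: e1_part_def e3_part_def poly_eq_iff coeff_parts)

lemma kq_elem_eq_iff:
  "kq_elem a1 a3 R M P N = kq_elem b1 b3 S M' P' N' \<longleftrightarrow>
     a1 = b1 \<and> a3 = b3 \<and> R = S \<and> M = M' \<and> P = P' \<and> N = N'"
  by (metis parts_kq_elem)

lemma eq_kq_elemI:
  assumes "\<And>p. \<not> valid_path p \<Longrightarrow> f p = 0"
    and "f (V1, []) = a1" "f (V3, []) = a3"
    and "\<And>k. f (V2, replicate k Be) = coeff R k" "\<And>k. f (V2, Al # replicate k Be) = coeff M k"
    and "\<And>k. f (V3, replicate k Be @ [Ga]) = coeff P k"
    and "\<And>k. f (V3, Al # replicate k Be @ [Ga]) = coeff N k"
  shows "f = kq_elem a1 a3 R M P N"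
proof
  fix p
  show "f p = kq_elem a1 a3 R M P N p"
  proof (cases "valid_path p")
    case True
    then show ?thesis by (cases rule: valid_path_cases) (simp_all add: assms(2-))
  next
    case False
    then show ?thesis using assms(1) kq_elem_valid by metis
  qed
qed

lemma kq_elem_parts:
  assumes "f \<in> kQ"
  shows "kq_elem (e1_part f) (e3_part f) (beta_part f) (alpha_part f) (gamma_part f) (alpha_gamma_part f) = f"
  using assms by (intro eq_kq_elemI[symmetric]) (auto simp: kQ_def coeff_parts e1_part_def e3_part_def)

lemma kQ_kq_elemE:
  assumes "f \<in> kQ"
  obtains a1 a3 R M P N where "f = kq_elem a1 a3 R M P N"
  using kq_elem_parts[OF assms] by metis

lemma alpha_eq_kq_elem: "alpha = kq_elem 0 0 0 1 0 0"
  by (rule eq_kq_elemI) (auto simp: alpha_def kq_path_def coeff_1)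

lemma gamma_eq_kq_elem: "gamma = kq_elem 0 0 0 0 1 0"
  by (rule eq_kq_elemI) (auto simp: gamma_def kq_path_def coeff_1)

lemma bpow_eq_kq_elem: "bpow i = kq_elem 0 0 (monom 1 i) 0 0 0"
  by (rule eq_kq_elemI) (auto simp: bpow_def kq_path_def coeff_monom)

lemma embed_eq_kq_elem: "embed v = kq_elem 0 0 v 0 0 0"
proof (rule eq_kq_elemI)
  fix p :: path assume "\<not> valid_path p"
  moreover have "valid_path p" if "fst p = V2" "\<forall>a\<in>set (snd p). a = Be"
    using that valid_path_simps(2)[of "length (snd p)"]
    by (metis prod.collapse replicate_length_same)
  ultimately show "embed v p = 0" by (auto simp: embed_def)
qed (auto simp: embed_def)

lemma kq_elem_add:
  "kq_add (kq_elem a1 a3 R M P N) (kq_elem b1 b3 S M' P' N') =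
     kq_elem (a1 + b1) (a3 + b3) (R + S) (M + M') (P + P') (N + N')"
  by (rule ext) (auto simp: kq_add_def kq_elem_def split: vert.split)

lemma kq_elem_diff:
  "kq_diff (kq_elem a1 a3 R M P N) (kq_elem b1 b3 S M' P' N') =
     kq_elem (a1 - b1) (a3 - b3) (R - S) (M - M') (P - P') (N - N')"
  by (rule ext) (auto simp: kq_diff_def kq_elem_def split: vert.split)

lemma kq_elem_smult:
  "kq_smult c (kq_elem a1 a3 R M P N) =
     kq_elem (c * a1) (c * a3) (smult c R) (smult c M) (smult c P) (smult c N)"
  by (rule ext) (auto simp: kq_smult_def kq_elem_def split: vert.split)

lemma kq_elem_zero: "(\<lambda>p. 0) = kq_elem 0 0 0 0 0 0"
  by (rule ext) (auto simp: kq_elem_def split: vert.split)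

lemma kq_diff_self: "kq_diff x x = (\<lambda>p. 0)"
  by (simp add: kq_diff_def)

lemma kq_elem_lincomb:
  assumes "finite S"
  shows "(\<lambda>p. \<Sum>i\<in>S. u i * kq_elem (a1 i) (a3 i) (R i) (M i) (P i) (N i) p) =
    kq_elem (\<Sum>i\<in>S. u i * a1 i) (\<Sum>i\<in>S. u i * a3 i) (\<Sum>i\<in>S. smult (u i) (R i))
      (\<Sum>i\<in>S. smult (u i) (M i)) (\<Sum>i\<in>S. smult (u i) (P i)) (\<Sum>i\<in>S. smult (u i) (N i))"
  using assms
proof (induction S rule: finite_induct)
  case empty
  then show ?case by (simp add: kq_elem_zero)
next
  case (insert i S)
  have "(\<lambda>p. \<Sum>j\<in>insert i S. u j * kq_elem (a1 j) (a3 j) (R j) (M j) (P j) (N j) p) =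
      kq_add (kq_smult (u i) (kq_elem (a1 i) (a3 i) (R i) (M i) (P i) (N i)))
        (\<lambda>p. \<Sum>j\<in>S. u j * kq_elem (a1 j) (a3 j) (R j) (M j) (P j) (N j) p)"
    using insert.hyps by (simp add: kq_add_def kq_smult_def)
  also have "\<dots> = kq_add (kq_smult (u i) (kq_elem (a1 i) (a3 i) (R i) (M i) (P i) (N i)))
      (kq_elem (\<Sum>j\<in>S. u j * a1 j) (\<Sum>j\<in>S. u j * a3 j) (\<Sum>j\<in>S. smult (u j) (R j))
        (\<Sum>j\<in>S. smult (u j) (M j)) (\<Sum>j\<in>S. smult (u j) (P j)) (\<Sum>j\<in>S. smult (u j) (N j)))"
    by (simp only: insert.IH)
  finally show ?case using insert by (simp add: kq_elem_smult kq_elem_add)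
qed

lemma ptgt_simps[simp]:
  "ptgt (v, []) = v" "ptgt (v, Al # w) = V1" "ptgt (v, Be # w) = V2" "ptgt (v, Ga # w) = V2"
  "ptgt (V2, replicate k Be) = V2" "ptgt (v, replicate k Be @ [Ga]) = V2"
  by (cases k; simp add: ptgt_def)+

lemma kq_mult_apply:
  assumes ff: "finite {q. f q \<noteq> 0}" and fg: "finite {r. g r \<noteq> 0}"
  shows "kq_mult f g (v, w) = (\<Sum>i\<le>length w. f (ptgt (v, drop i w), take i w) * g (v, drop i w))"
proof -
  let ?Sf = "{q. f q \<noteq> 0}" and ?Sg = "{r. g r \<noteq> 0}"
  let ?C = "\<lambda>x. psrc (fst x) = ptgt (snd x) \<and> (fst (snd x), snd (fst x) @ snd (snd x)) = (v, w)"
  let ?split = "\<lambda>i. ((ptgt (v, drop i w), take i w), (v, drop i w))"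
  let ?K = "{i \<in> {..length w}. ?split i \<in> ?Sf \<times> ?Sg}"
  have "kq_mult f g (v, w) = (\<Sum>x\<in>?Sf \<times> ?Sg. if ?C x then f (fst x) * g (snd x) else 0)"
    unfolding kq_mult_def by (simp add: sum.cartesian_product split_beta)
  also have "\<dots> = (\<Sum>x\<in>{x \<in> ?Sf \<times> ?Sg. ?C x}. f (fst x) * g (snd x))"
    by (rule sum.inter_filter[symmetric]) (use ff fg in auto)
  also have "{x \<in> ?Sf \<times> ?Sg. ?C x} = ?split ` ?K"
  proof (intro equalityI subsetI)
    fix x assume x: "x \<in> {x \<in> ?Sf \<times> ?Sg. ?C x}"
    obtain qv qw rv rw where xqr: "x = ((qv, qw), (rv, rw))" by (metis prod.collapse)
    then have "qv = ptgt (rv, rw)" "rv = v" "qw @ rw = w" using x by (auto simp: psrc_def)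
    then have "x = ?split (length qw)" "length qw \<le> length w" using xqr by auto
    then show "x \<in> ?split ` ?K" using x by auto
  qed (auto simp: psrc_def)
  also have "(\<Sum>x\<in>?split ` ?K. f (fst x) * g (snd x)) = (\<Sum>i\<in>?K. f (fst (?split i)) * g (snd (?split i)))"
    by (rule sum.reindex[unfolded comp_def]) (auto intro!: inj_onI dest!: arg_cong[where f = length])
  also have "\<dots> = (\<Sum>i\<le>length w. f (ptgt (v, drop i w), take i w) * g (v, drop i w))"
    unfolding fst_conv snd_conv by (rule sum.mono_neutral_left) auto
  finally show ?thesis .
qed

lemma kq_mult_vanishes_off_valid:
  assumes f: "f \<in> kQ" and g: "g \<in> kQ" and p: "\<not> valid_path (v, w)"
  shows "kq_mult f g (v, w) = 0"
proof -
  have terms: "f (ptgt (v, drop i w), take i w) * g (v, drop i w) = 0" for i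
  proof (rule ccontr)
    assume "f (ptgt (v, drop i w), take i w) * g (v, drop i w) \<noteq> 0"
    then have "valid_path (ptgt (v, drop i w), take i w)" "valid_path (v, drop i w)"
      using f g by (auto simp: kQ_def)
    moreover have "valid_path (v, w)" if "valid_path (ptgt (v, drop i w), take i w)"
      "valid_path (v, drop i w)"
    proof (cases "drop i w = []")
      case True
      then show ?thesis using that(1) by simp
    next
      case False
      then have "chain (take i w @ drop i w)"
        using that unfolding chain_append by (auto simp: valid_path_def ptgt_def)
      then show ?thesis using that(2) False by (simp add: valid_path_def)
    qed
    ultimately have "valid_path (v, w)" by blast
    then show False using p by simp
  qed
  have "kq_mult f g (v, w) = (\<Sum>i\<le>length w. f (ptgt (v, drop i w), take i w) * g (v, drop i w))"
    using f g by (simp add: kq_mult_apply kQ_def)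
  also have "\<dots> = 0" by (rule sum.neutral) (use terms in blast)
  finally show ?thesis .
qed

lemma sum_atMost_Suc_Suc_shift:
  "(\<Sum>i\<le>Suc (Suc k). h i) = h 0 + (\<Sum>i\<le>k. h (Suc i)) + (h (Suc (Suc k)) :: 'b::comm_monoid_add)"
proof -
  have "(\<Sum>i\<le>Suc (Suc k). h i) = h 0 + (\<Sum>i\<le>Suc k. h (Suc i))" by (rule sum.atMost_Suc_shift)
  then show ?thesis by (simp add: add.assoc)
qed

lemma kq_elem_mult:
  "kq_mult (kq_elem a1 a3 R M P N) (kq_elem b1 b3 S M' P' N') =
     kq_elem (a1 * b1) (a3 * b3) (R * S) (smult a1 M' + M * S) (R * P' + smult b3 P)
       (smult a1 N' + M * P' + smult b3 N)"
  (is "kq_mult ?f ?g = _")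
proof (rule eq_kq_elemI)
  note mult = kq_mult_apply[OF finite_kq_elem_support finite_kq_elem_support]
  show "kq_mult ?f ?g p = 0" if "\<not> valid_path p" for p
    using that kq_mult_vanishes_off_valid[of ?f ?g "fst p" "snd p"] by simp
  show "kq_mult ?f ?g (V1, []) = a1 * b1" "kq_mult ?f ?g (V3, []) = a3 * b3"
    by (simp_all add: mult)
  show "kq_mult ?f ?g (V2, replicate k Be) = coeff (R * S) k" for k
    by (simp add: mult coeff_mult min_def)
  show "kq_mult ?f ?g (V2, Al # replicate k Be) = coeff (smult a1 M' + M * S) k" for k
    by (simp add: mult coeff_mult sum.atMost_Suc_shift min_def del: sum.atMost_Suc)
  show "kq_mult ?f ?g (V3, replicate k Be @ [Ga]) = coeff (R * P' + smult b3 P) k" for k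
    by (simp add: mult coeff_mult min_def mult.commute[of _ b3])
  show "kq_mult ?f ?g (V3, Al # replicate k Be @ [Ga]) = coeff (smult a1 N' + M * P' + smult b3 N) k" for k
    by (simp add: mult coeff_mult sum_atMost_Suc_Suc_shift min_def mult.commute[of _ b3]
        del: sum.atMost_Suc)
qed

section \<open>The ideal in coordinates\<close>

interpretation poly_vs: vector_space "smult :: 'a::field \<Rightarrow> 'a poly \<Rightarrow> 'a poly"
  by unfold_locales (simp_all add: smult_add_right smult_add_left)

lemma poly_subspace_iff: "poly_subspace V \<longleftrightarrow> poly_vs.subspace V"
  by (simp add: poly_subspace_def poly_vs.subspace_def)

lemma monom_1_dvd_mono: "monom 1 a dvd p \<Longrightarrow> b \<le> a \<Longrightarrow> monom 1 b dvd p"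
  by (simp add: monom_1_dvd_iff')

definition I_coords :: "nat \<Rightarrow> nat \<Rightarrow> nat \<Rightarrow> 'a::field poly set \<Rightarrow> 'a kqel set" where
  "I_coords n n' n'' V = {kq_elem 0 0 R M P N | R M P N.
     monom 1 n dvd R \<and> monom 1 n' dvd M \<and> monom 1 n'' dvd P \<and> N \<in> V}"

locale quiver_ideal =
  fixes n n' n'' :: nat and V :: "'a::field poly set"
  assumes n'_le_n: "n' \<le> n" and n''_le_n: "n'' \<le> n"
    and poly_subspace_V: "poly_subspace V"
    and monom_dvd_in_V: "\<And>p. monom 1 (min n' n'') dvd p \<Longrightarrow> p \<in> V"
begin

abbreviation "m \<equiv> min n' n''"
abbreviation "I \<equiv> I_ideal n n' n'' V"

lemma subspace_V: "poly_vs.subspace V"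
  using poly_subspace_V by (simp add: poly_subspace_iff)

lemma I_coordsI:
  "monom 1 n dvd R \<Longrightarrow> monom 1 n' dvd M \<Longrightarrow> monom 1 n'' dvd P \<Longrightarrow> N \<in> V \<Longrightarrow>
     kq_elem 0 0 R M P N \<in> I_coords n n' n'' V"
  unfolding I_coords_def by blast

lemma I_coordsE:
  assumes "x \<in> I_coords n n' n'' V"
  obtains R M P N where "x = kq_elem 0 0 R M P N"
    "monom 1 n dvd R" "monom 1 n' dvd M" "monom 1 n'' dvd P" "N \<in> V"
  using assms unfolding I_coords_def by blast

lemma generators_in_I_coords:
  assumes "s \<in> {kq_mult alpha (bpow n'), bpow n, kq_mult (bpow n'') gamma} \<union>
    {kq_mult alpha (kq_mult (embed v) gamma) | v. v \<in> V}"
  shows "s \<in> I_coords n n' n'' V"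
proof -
  have "0 \<in> V" using subspace_V by (rule poly_vs.subspace_0)
  from assms consider "s = kq_mult alpha (bpow n')" | "s = bpow n" | "s = kq_mult (bpow n'') gamma"
    | v where "s = kq_mult alpha (kq_mult (embed v) gamma)" "v \<in> V"
    by blast
  then show ?thesis
  proof cases
    case 1
    then show ?thesis using \<open>0 \<in> V\<close>
      by (simp add: alpha_eq_kq_elem bpow_eq_kq_elem kq_elem_mult I_coordsI)
  next
    case 2
    then show ?thesis using \<open>0 \<in> V\<close> by (simp add: bpow_eq_kq_elem I_coordsI)
  next
    case 3
    then show ?thesis using \<open>0 \<in> V\<close>
      by (simp add: gamma_eq_kq_elem bpow_eq_kq_elem kq_elem_mult I_coordsI)
  next
    case 4
    then show ?thesis
      by (simp add: alpha_eq_kq_elem gamma_eq_kq_elem embed_eq_kq_elem kq_elem_mult I_coordsI)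
  qed
qed

lemma I_coords_lmult:
  assumes "a \<in> kQ" "x \<in> I_coords n n' n'' V"
  shows "kq_mult a x \<in> I_coords n n' n'' V"
proof -
  obtain R M P N where x: "x = kq_elem 0 0 R M P N"
    "monom 1 n dvd R" "monom 1 n' dvd M" "monom 1 n'' dvd P" "N \<in> V"
    using assms(2) by (rule I_coordsE)
  obtain a1 a3 Ra Ma Pa Na where a: "a = kq_elem a1 a3 Ra Ma Pa Na"
    using assms(1) by (rule kQ_kq_elemE)
  have "monom 1 n' dvd R" using x(2) n'_le_n by (rule monom_1_dvd_mono)
  moreover have "monom 1 m dvd P" using x(4) by (rule monom_1_dvd_mono) simp
  ultimately have "monom 1 n' dvd smult a1 M + Ma * R" "smult a1 N + Ma * P \<in> V"
    using x(3,5) subspace_V monom_dvd_in_V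
    by (auto intro: dvd_add dvd_smult dvd_mult poly_vs.subspace_add poly_vs.subspace_scale)
  moreover have "kq_mult a x = kq_elem 0 0 (Ra * R) (smult a1 M + Ma * R) (Ra * P) (smult a1 N + Ma * P)"
    by (simp add: x a kq_elem_mult)
  ultimately show ?thesis using x(2,4) by (auto intro!: I_coordsI dvd_mult)
qed

lemma I_coords_rmult:
  assumes "a \<in> kQ" "x \<in> I_coords n n' n'' V"
  shows "kq_mult x a \<in> I_coords n n' n'' V"
proof -
  obtain R M P N where x: "x = kq_elem 0 0 R M P N"
    "monom 1 n dvd R" "monom 1 n' dvd M" "monom 1 n'' dvd P" "N \<in> V"
    using assms(2) by (rule I_coordsE)
  obtain a1 a3 Ra Ma Pa Na where a: "a = kq_elem a1 a3 Ra Ma Pa Na"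
    using assms(1) by (rule kQ_kq_elemE)
  have "monom 1 n'' dvd R" using x(2) n''_le_n by (rule monom_1_dvd_mono)
  moreover have "monom 1 m dvd M" using x(3) by (rule monom_1_dvd_mono) simp
  ultimately have "monom 1 n'' dvd R * Pa + smult a3 P" "M * Pa + smult a3 N \<in> V"
    using x(4,5) subspace_V monom_dvd_in_V
    by (auto intro: dvd_add dvd_smult dvd_mult2 poly_vs.subspace_add poly_vs.subspace_scale)
  moreover have "kq_mult x a = kq_elem 0 0 (R * Ra) (M * Ra) (R * Pa + smult a3 P) (M * Pa + smult a3 N)"
    by (simp add: x a kq_elem_mult)
  ultimately show ?thesis using x(2,3) by (auto intro!: I_coordsI dvd_mult2)
qed

lemma I_subset_I_coords: "x \<in> I \<Longrightarrow> x \<in> I_coords n n' n'' V"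
  unfolding I_ideal_def
proof (induction x rule: kq_ideal.induct)
  case zero
  show ?case using poly_vs.subspace_0[OF subspace_V] by (simp add: kq_elem_zero I_coordsI)
next
  case (add x y)
  then show ?case
    by (auto elim!: I_coordsE simp: kq_elem_add
        intro!: I_coordsI poly_vs.subspace_add[OF subspace_V])
qed (simp_all add: generators_in_I_coords I_coords_lmult I_coords_rmult)

lemma I_coords_subset_I:
  assumes "x \<in> I_coords n n' n'' V"
  shows "x \<in> I"
proof -
  let ?G = "{kq_mult alpha (bpow n'), bpow n, kq_mult (bpow n'') gamma} \<union>
    {kq_mult alpha (kq_mult (embed v) gamma) | v. v \<in> V}"
  obtain R M P N where x: "x = kq_elem 0 0 R M P N"
    and N: "N \<in> V" and "monom 1 n dvd R" "monom 1 n' dvd M" "monom 1 n'' dvd P"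
    using assms by (rule I_coordsE)
  then obtain R1 M1 P1 where R1: "R = monom 1 n * R1" and M1: "M = monom 1 n' * M1"
    and P1: "P = monom 1 n'' * P1" by (auto elim!: dvdE)
  have "x = kq_add (kq_add (kq_add
      (kq_mult (bpow n) (kq_elem 0 0 R1 0 0 0))
      (kq_mult (kq_mult alpha (bpow n')) (kq_elem 0 0 M1 0 0 0)))
      (kq_mult (kq_elem 0 0 P1 0 0 0) (kq_mult (bpow n'') gamma)))
      (kq_mult alpha (kq_mult (embed N) gamma))"
    by (simp add: x R1 M1 P1 alpha_eq_kq_elem gamma_eq_kq_elem bpow_eq_kq_elem embed_eq_kq_elem
        kq_elem_mult kq_elem_add mult.commute)
  also have "\<dots> \<in> kq_ideal ?G"
  proof (intro kq_ideal.add)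
    show "kq_mult (bpow n) (kq_elem 0 0 R1 0 0 0) \<in> kq_ideal ?G"
      by (rule kq_ideal.rmult) (auto intro: kq_ideal.gen)
    show "kq_mult (kq_mult alpha (bpow n')) (kq_elem 0 0 M1 0 0 0) \<in> kq_ideal ?G"
      by (rule kq_ideal.rmult) (auto intro: kq_ideal.gen)
    show "kq_mult (kq_elem 0 0 P1 0 0 0) (kq_mult (bpow n'') gamma) \<in> kq_ideal ?G"
      by (rule kq_ideal.lmult) (auto intro: kq_ideal.gen)
    show "kq_mult alpha (kq_mult (embed N) gamma) \<in> kq_ideal ?G"
      using N by (auto intro: kq_ideal.gen)
  qed
  finally show ?thesis unfolding I_ideal_def .
qed

lemma kq_elem_in_I_iff:
  "kq_elem a1 a3 R M P N \<in> I \<longleftrightarrow>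
     a1 = 0 \<and> a3 = 0 \<and> monom 1 n dvd R \<and> monom 1 n' dvd M \<and> monom 1 n'' dvd P \<and> N \<in> V"
proof
  assume "kq_elem a1 a3 R M P N \<in> I"
  from I_subset_I_coords[OF this] obtain R' M' P' N' where
    "kq_elem a1 a3 R M P N = kq_elem 0 0 R' M' P' N'"
    "monom 1 n dvd R'" "monom 1 n' dvd M'" "monom 1 n'' dvd P'" "N' \<in> V"
    by (rule I_coordsE)
  then show "a1 = 0 \<and> a3 = 0 \<and> monom 1 n dvd R \<and> monom 1 n' dvd M \<and> monom 1 n'' dvd P \<and> N \<in> V"
    by (simp add: kq_elem_eq_iff)
qed (auto intro: I_coords_subset_I I_coordsI)

lemma zero_in_I: "(\<lambda>p. 0) \<in> I"
  unfolding I_ideal_def by (rule kq_ideal.zero)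

end

section \<open>Supports of polynomials and independent families of operators\<close>

definition poly_supp :: "'a::zero poly \<Rightarrow> nat set" where
  "poly_supp p = {j. coeff p j \<noteq> 0}"

lemma poly_supp_0[simp]: "poly_supp 0 = {}"
  by (simp add: poly_supp_def)

lemma poly_supp_add: "poly_supp (p + q) \<subseteq> poly_supp p \<union> poly_supp q"
  by (auto simp: poly_supp_def)

lemma poly_supp_smult: "poly_supp (smult c p) \<subseteq> poly_supp p"
  by (auto simp: poly_supp_def)

lemma poly_supp_monom: "poly_supp (monom 1 k :: 'a::zero_neq_one poly) = {k}"
  by (auto simp: poly_supp_def coeff_monom)

lemma poly_supp_lincomb:
  "poly_supp (\<Sum>i\<in>S. smult (u i) (p i)) \<subseteq> (\<Union>i\<in>S. poly_supp (p i))"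
proof
  fix j assume "j \<in> poly_supp (\<Sum>i\<in>S. smult (u i) (p i))"
  then have "(\<Sum>i\<in>S. u i * coeff (p i) j) \<noteq> 0" by (simp add: poly_supp_def coeff_sum)
  then obtain i where "i \<in> S" "u i * coeff (p i) j \<noteq> 0" by (meson sum.neutral)
  then have "i \<in> S" "coeff (p i) j \<noteq> 0" by auto
  then show "j \<in> (\<Union>i\<in>S. poly_supp (p i))" by (auto simp: poly_supp_def)
qed

lemma subspace_poly_supp: "poly_vs.subspace {p :: 'a::field poly. poly_supp p \<subseteq> T}"
  unfolding poly_vs.subspace_def
proof (intro conjI ballI allI)
  fix p q :: "'a poly" assume "p \<in> {p. poly_supp p \<subseteq> T}" "q \<in> {p. poly_supp p \<subseteq> T}"
  then show "p + q \<in> {p. poly_supp p \<subseteq> T}" using poly_supp_add[of p q] by blast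
next
  fix c and p :: "'a poly" assume "p \<in> {p. poly_supp p \<subseteq> T}"
  then show "smult c p \<in> {p. poly_supp p \<subseteq> T}" using poly_supp_smult[of c p] by blast
qed simp

lemma independent_family_monom:
  assumes "finite S"
  shows "independent_family smult (monom 1) S"
  unfolding independent_family_def
proof (intro allI impI ballI)
  fix u :: "nat \<Rightarrow> 'a" and i assume "(\<Sum>j\<in>S. smult (u j) (monom 1 j)) = 0" and "i \<in> S"
  then have "0 = coeff (\<Sum>j\<in>S. smult (u j) (monom 1 j)) i" by simp
  also have "\<dots> = (\<Sum>j\<in>S. if j = i then u j else 0)"
    by (simp add: coeff_sum coeff_monom) (intro sum.cong; simp)
  also have "\<dots> = u i" using assms \<open>i \<in> S\<close> by simp
  finally show "u i = 0" by simp
qed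

abbreviation smult_pair :: "'a::field \<Rightarrow> 'a poly \<times> 'a poly \<Rightarrow> 'a poly \<times> 'a poly" where
  "smult_pair c \<equiv> map_prod (smult c) (smult c)"

interpretation pair_vs: vector_space smult_pair
  by unfold_locales (auto simp: smult_add_right smult_add_left)

lemma subspace_pair_poly_supp:
  "pair_vs.subspace {\<Theta> :: 'a::field poly \<times> 'a poly. poly_supp (fst \<Theta>) \<subseteq> S \<and> poly_supp (snd \<Theta>) \<subseteq> T}"
  unfolding pair_vs.subspace_def
proof (intro conjI ballI allI)
  fix x y :: "'a poly \<times> 'a poly" assume "x \<in> {\<Theta>. poly_supp (fst \<Theta>) \<subseteq> S \<and> poly_supp (snd \<Theta>) \<subseteq> T}"
    "y \<in> {\<Theta>. poly_supp (fst \<Theta>) \<subseteq> S \<and> poly_supp (snd \<Theta>) \<subseteq> T}"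
  then show "x + y \<in> {\<Theta>. poly_supp (fst \<Theta>) \<subseteq> S \<and> poly_supp (snd \<Theta>) \<subseteq> T}"
    using poly_supp_add[of "fst x" "fst y"] poly_supp_add[of "snd x" "snd y"] by auto
next
  fix c and x :: "'a poly \<times> 'a poly" assume "x \<in> {\<Theta>. poly_supp (fst \<Theta>) \<subseteq> S \<and> poly_supp (snd \<Theta>) \<subseteq> T}"
  then show "smult_pair c x \<in> {\<Theta>. poly_supp (fst \<Theta>) \<subseteq> S \<and> poly_supp (snd \<Theta>) \<subseteq> T}"
    using poly_supp_smult[of c "fst x"] poly_supp_smult[of c "snd x"] by (auto simp: map_prod_def split_beta)
qed (simp add: zero_prod_def)

lemma independent_family_monom_pairs:
  assumes "finite S" "finite T"
  shows "independent_family smult_pair (case_sum (\<lambda>j. (monom 1 j, 0)) (\<lambda>j. (0, monom 1 j)))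
    (Inl ` S \<union> Inr ` T)"
  unfolding independent_family_def
proof (intro allI impI ballI)
  fix u :: "nat + nat \<Rightarrow> 'a" and i
  assume sum0: "(\<Sum>i\<in>Inl ` S \<union> Inr ` T.
      smult_pair (u i) (case_sum (\<lambda>j. (monom 1 j, 0)) (\<lambda>j. (0, monom 1 j)) i)) = 0"
    and i: "i \<in> Inl ` S \<union> Inr ` T"
  have "Inl ` S \<inter> Inr ` T = {}" by auto
  then have "(\<Sum>i\<in>Inl ` S \<union> Inr ` T. smult_pair (u i) (case_sum (\<lambda>j. (monom 1 j, 0)) (\<lambda>j. (0, monom 1 j)) i))
      = ((\<Sum>j\<in>S. smult (u (Inl j)) (monom 1 j)), (\<Sum>j\<in>T. smult (u (Inr j)) (monom 1 j)))"
    using assms by (simp add: sum.union_disjoint sum.reindex sum_prod)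
  then have "(\<Sum>j\<in>S. smult ((u \<circ> Inl) j) (monom 1 j)) = 0" "(\<Sum>j\<in>T. smult ((u \<circ> Inr) j) (monom 1 j)) = 0"
    using sum0 by (simp_all add: zero_prod_def)
  then show "u i = 0"
    using i independent_family_monom[OF assms(1)] independent_family_monom[OF assms(2)]
    by (auto dest: poly_vs.independent_familyD)
qed

lemma independent_family_extend_monoms:
  assumes indep: "independent_family smult_pair W {..c}" and "c \<le> N"
    and low: "\<And>k. k \<le> c \<Longrightarrow> poly_supp (snd (W k)) \<subseteq> {..<m}"
  shows "independent_family smult_pair (\<lambda>k. if k \<le> c then W k else (0, monom 1 (m + k - Suc c))) {..N}"
  unfolding independent_family_def
proof (intro allI impI ballI)
  fix u :: "nat \<Rightarrow> 'a" and i
  let ?W = "\<lambda>k. if k \<le> c then W k else (0, monom 1 (m + k - Suc c))"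
  assume sum0: "(\<Sum>k\<in>{..N}. smult_pair (u k) (?W k)) = 0" and "i \<in> {..N}"
  have high: "u l = 0" if "c < l" "l \<le> N" for l
  proof -
    have "coeff (snd (\<Sum>k\<in>{..N}. smult_pair (u k) (?W k))) (m + l - Suc c)
        = (\<Sum>k\<in>{..N}. if k = l then u k else 0)"
      unfolding snd_sum coeff_sum
    proof (intro sum.cong refl)
      fix k assume "k \<in> {..N}"
      show "coeff (snd (smult_pair (u k) (?W k))) (m + l - Suc c) = (if k = l then u k else 0)"
      proof (cases "k \<le> c")
        case True
        then have "coeff (snd (W k)) (m + l - Suc c) = 0"
          using low[OF True] that by (auto simp: poly_supp_def)
        then show ?thesis using True that by auto
      qed (use that in \<open>auto simp: coeff_monom\<close>)
    qed
    then show ?thesis using sum0 that by (simp add: zero_prod_def)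
  qed
  have "(\<Sum>k\<in>{..c}. smult_pair (u k) (W k)) = (\<Sum>k\<in>{..N}. smult_pair (u k) (?W k))"
    using \<open>c \<le> N\<close> high by (intro sum.mono_neutral_cong_left) (auto simp: zero_prod_def)
  then have "\<forall>k\<le>c. u k = 0" using sum0 indep by (auto intro: pair_vs.independent_familyD)
  then show "u i = 0" using high \<open>i \<in> {..N}\<close> by (cases "i \<le> c") auto
qed

section \<open>Operators on k[beta] and the derivations they induce\<close>

text \<open>A pair \<open>\<Theta> = (A, F)\<close> stands for the operator \<open>A + F d/d\<beta>\<close> on k[beta].\<close>
definition theta_stable :: "'a::field poly set \<Rightarrow> 'a poly \<times> 'a poly \<Rightarrow> bool" where
  "theta_stable V \<Theta> \<longleftrightarrow> (\<forall>v\<in>V. fst \<Theta> * v + snd \<Theta> * pderiv v \<in> V)"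

text \<open>The derivation of kQ with \<open>e\<^sub>i, \<gamma> \<mapsto> 0\<close>, \<open>\<beta> \<mapsto> F(\<beta>)\<close> and \<open>\<alpha> \<mapsto> \<alpha> A(\<beta>)\<close>; on
  \<open>\<alpha> k[\<beta>] \<gamma>\<close> it acts as \<open>\<Theta>\<close>.\<close>
definition theta_der :: "'a::field poly \<times> 'a poly \<Rightarrow> 'a kqel \<Rightarrow> 'a kqel" where
  "theta_der \<Theta> x = kq_elem 0 0
     (snd \<Theta> * pderiv (beta_part x))
     (fst \<Theta> * alpha_part x + snd \<Theta> * pderiv (alpha_part x))
     (snd \<Theta> * pderiv (gamma_part x))
     (fst \<Theta> * alpha_gamma_part x + snd \<Theta> * pderiv (alpha_gamma_part x))"

lemma theta_der_kq_elem[simp]: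
  "theta_der (A, F) (kq_elem a1 a3 R M P N) =
     kq_elem 0 0 (F * pderiv R) (A * M + F * pderiv M) (F * pderiv P) (A * N + F * pderiv N)"
  by (simp add: theta_der_def)

lemma theta_der_add:
  "theta_der (A, F) (kq_add (kq_elem a1 a3 R M P N) (kq_elem b1 b3 S M' P' N')) =
     kq_add (theta_der (A, F) (kq_elem a1 a3 R M P N)) (theta_der (A, F) (kq_elem b1 b3 S M' P' N'))"
  by (simp add: kq_elem_add pderiv_add algebra_simps)

lemma theta_der_smult:
  "theta_der (A, F) (kq_smult c (kq_elem a1 a3 R M P N)) =
     kq_smult c (theta_der (A, F) (kq_elem a1 a3 R M P N))"
  by (simp add: kq_elem_smult pderiv_smult smult_add_right algebra_simps)

lemma theta_der_mult:
  "theta_der (A, F) (kq_mult (kq_elem a1 a3 R M P N) (kq_elem b1 b3 S M' P' N')) =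
     kq_add (kq_mult (theta_der (A, F) (kq_elem a1 a3 R M P N)) (kq_elem b1 b3 S M' P' N'))
       (kq_mult (kq_elem a1 a3 R M P N) (theta_der (A, F) (kq_elem b1 b3 S M' P' N')))"
  by (simp add: kq_elem_mult kq_elem_add pderiv_add pderiv_smult pderiv_mult kq_elem_eq_iff
      smult_add_right algebra_simps)

lemma theta_der_lincomb:
  fixes W :: "'i \<Rightarrow> 'a::field poly \<times> 'a poly" and u :: "'i \<Rightarrow> 'a"
  assumes "finite S"
  shows "(\<lambda>x p. \<Sum>i\<in>S. u i * theta_der (W i) x p) = theta_der (\<Sum>i\<in>S. smult_pair (u i) (W i))"
proof (rule ext)
  fix x :: "'a kqel"
  have "(\<lambda>p. \<Sum>i\<in>S. u i * theta_der (W i) x p) = kq_elem 0 0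
      (\<Sum>i\<in>S. smult (u i) (snd (W i) * pderiv (beta_part x)))
      (\<Sum>i\<in>S. smult (u i) (fst (W i) * alpha_part x + snd (W i) * pderiv (alpha_part x)))
      (\<Sum>i\<in>S. smult (u i) (snd (W i) * pderiv (gamma_part x)))
      (\<Sum>i\<in>S. smult (u i) (fst (W i) * alpha_gamma_part x + snd (W i) * pderiv (alpha_gamma_part x)))"
    unfolding theta_der_def
    using kq_elem_lincomb[OF assms, of u "\<lambda>_. 0" "\<lambda>_. 0" "\<lambda>i. snd (W i) * pderiv (beta_part x)"
        "\<lambda>i. fst (W i) * alpha_part x + snd (W i) * pderiv (alpha_part x)"
        "\<lambda>i. snd (W i) * pderiv (gamma_part x)"
        "\<lambda>i. fst (W i) * alpha_gamma_part x + snd (W i) * pderiv (alpha_gamma_part x)"]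
    by simp
  also have "\<dots> = theta_der (\<Sum>i\<in>S. smult_pair (u i) (W i)) x"
    by (simp add: theta_der_def fst_sum snd_sum sum_distrib_right smult_add_right sum.distrib)
  finally show "(\<lambda>p. \<Sum>i\<in>S. u i * theta_der (W i) x p) = theta_der (\<Sum>i\<in>S. smult_pair (u i) (W i)) x" .
qed

lemma monom_1_dvd_mult_pderiv:
  fixes F G :: "'a::field poly"
  assumes F0: "of_nat k * coeff F 0 = 0" and G: "monom 1 k dvd G"
  shows "monom 1 k dvd F * pderiv G"
proof (cases k)
  case 0
  then show ?thesis by simp
next
  case (Suc k')
  obtain G1 where G1: "G = monom 1 k * G1" using G by blast
  define a where "a = coeff F 0"
  have "monom 1 1 dvd F - [:a:]" by (simp add: monom_1_dvd_iff' a_def)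
  then obtain Q where "F - [:a:] = monom 1 1 * Q" by blast
  then have F: "F = [:a:] + monom 1 1 * Q" by (simp add: algebra_simps)
  have "pderiv G = monom 1 k * pderiv G1 + G1 * monom (of_nat k) k'"
    using Suc by (simp add: G1 pderiv_mult pderiv_monom)
  then have "F * pderiv G = ([:a:] + monom 1 1 * Q) * (monom 1 k * pderiv G1 + G1 * monom (of_nat k) k')"
    by (simp only: F)
  also have "\<dots> = monom 1 k * (F * pderiv G1) + G1 * ([:a:] * monom (of_nat k) k')
      + Q * G1 * (monom 1 1 * monom (of_nat k) k')"
    by (simp add: F algebra_simps)
  also have "[:a:] * monom (of_nat k) k' = 0"
    using F0 by (auto simp: a_def smult_monom mult.commute)
  also have "monom 1 1 * monom (of_nat k) k' = monom 1 k * [:of_nat k:]"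
    using Suc by (simp add: mult_monom monom_0[symmetric])
  finally have "F * pderiv G = monom 1 k * (F * pderiv G1 + Q * G1 * [:of_nat k:])"
    by (simp add: algebra_simps)
  then show ?thesis by simp
qed

lemma of_nat_mult_eq_0_dvd:
  "of_nat g * (a :: 'a::semiring_1) = 0 \<Longrightarrow> g dvd k \<Longrightarrow> of_nat k * a = 0"
  by (metis dvdE mult.assoc mult.commute mult_zero_right of_nat_mult)

lemma hh1_dim_gt_imp_nonzero: "hh1_dim_gt I N \<Longrightarrow> hh1_nonzero I"
proof -
  assume "hh1_dim_gt I N"
  then obtain Ds where der: "is_lam_der I (Ds 0)"
    and indep: "\<And>cs. is_lam_inner I (\<lambda>x p. \<Sum>i\<le>N. cs i * Ds i x p) \<Longrightarrow> cs 0 = 0"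
    unfolding hh1_dim_gt_def by blast
  have "\<not> is_lam_inner I (Ds 0)"
  proof
    assume "is_lam_inner I (Ds 0)"
    moreover have "(\<lambda>x p. \<Sum>i\<le>N. (if i = 0 then 1 else 0) * Ds i x p) = Ds 0"
      by (simp add: if_distrib[of "\<lambda>c. c * _"] cong: if_cong)
    ultimately show False using indep[of "\<lambda>i. if i = 0 then 1 else 0"] by simp
  qed
  then show "hh1_nonzero I" using der unfolding hh1_nonzero_def by blast
qed

lemma Dprime_nonzero_if_stable_theta:
  assumes "theta_stable V \<Theta>" "\<Theta> \<noteq> 0"
    and A: "poly_supp (fst \<Theta>) \<subseteq> {1..<m}" and F: "poly_supp (snd \<Theta>) \<subseteq> {1..<m}"
  shows "Dprime_nonzero V m"
proof -
  obtain A F where \<Theta>: "\<Theta> = (A, F)" by fastforce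
  have "\<not> ((\<exists>c. monom 1 m dvd A - [:c:]) \<and> monom 1 m dvd F)"
  proof
    assume "(\<exists>c. monom 1 m dvd A - [:c:]) \<and> monom 1 m dvd F"
    then obtain c where "monom 1 m dvd A - [:c:]" "monom 1 m dvd F" by blast
    then have "coeff A j = 0" "coeff F j = 0" for j
      using A F \<Theta> by (cases "j < m"; cases j; force simp: monom_1_dvd_iff' poly_supp_def)+
    then show False using \<open>\<Theta> \<noteq> 0\<close> \<Theta> by (simp add: zero_prod_def poly_eq_iff)
  qed
  moreover have "coeff F 0 = 0" using F \<Theta> by (auto simp: poly_supp_def)
  ultimately show ?thesis
    using \<open>theta_stable V \<Theta>\<close> \<Theta> unfolding Dprime_nonzero_def theta_stable_def by auto
qed

context quiver_ideal
begin

abbreviation "delta \<equiv> gcd n (gcd n' n'')"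

lemma delta_dvd: "delta dvd n" "delta dvd n'" "delta dvd n''" "delta dvd m"
  by (simp_all add: min_def) (meson dvd_trans gcd_dvd1 gcd_dvd2)+

lemma theta_der_respects_I:
  assumes stable: "theta_stable V (A, F)" and F0: "of_nat delta * coeff F 0 = 0"
    and "x \<in> kQ" "y \<in> kQ" and xy: "kq_diff x y \<in> I"
  shows "kq_diff (theta_der (A, F) x) (theta_der (A, F) y) \<in> I"
proof -
  obtain a1 a3 R M P N where x: "x = kq_elem a1 a3 R M P N"
    using \<open>x \<in> kQ\<close> by (rule kQ_kq_elemE)
  obtain b1 b3 S M' P' N' where y: "y = kq_elem b1 b3 S M' P' N'"
    using \<open>y \<in> kQ\<close> by (rule kQ_kq_elemE)
  have F0': "of_nat n * coeff F 0 = 0" "of_nat n' * coeff F 0 = 0" "of_nat n'' * coeff F 0 = 0"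
    using of_nat_mult_eq_0_dvd[OF F0] delta_dvd by blast+
  have dvd: "monom 1 n dvd R - S" "monom 1 n' dvd M - M'" "monom 1 n'' dvd P - P'"
    and "N - N' \<in> V"
    using xy by (simp_all add: x y kq_elem_diff kq_elem_in_I_iff)
  then have "A * (N - N') + F * pderiv (N - N') \<in> V"
    using stable by (simp add: theta_stable_def)
  moreover have "monom 1 n dvd F * pderiv (R - S)" "monom 1 n'' dvd F * pderiv (P - P')"
    using F0' dvd by (auto intro: monom_1_dvd_mult_pderiv)
  moreover have "monom 1 n' dvd A * (M - M') + F * pderiv (M - M')"
    using F0' dvd by (intro dvd_add[OF dvd_mult monom_1_dvd_mult_pderiv])
  ultimately have "kq_elem 0 0 (F * pderiv (R - S)) (A * (M - M') + F * pderiv (M - M'))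
      (F * pderiv (P - P')) (A * (N - N') + F * pderiv (N - N')) \<in> I"
    by (simp add: kq_elem_in_I_iff)
  moreover have "kq_diff (theta_der (A, F) x) (theta_der (A, F) y) =
      kq_elem 0 0 (F * pderiv (R - S)) (A * (M - M') + F * pderiv (M - M'))
        (F * pderiv (P - P')) (A * (N - N') + F * pderiv (N - N'))"
    by (simp add: x y kq_elem_diff kq_elem_eq_iff pderiv_diff algebra_simps)
  ultimately show ?thesis by simp
qed

lemma theta_der_is_lam_der:
  assumes "theta_stable V (A, F)" and "of_nat delta * coeff F 0 = 0"
  shows "is_lam_der I (theta_der (A, F))"
  unfolding is_lam_der_def
proof (intro conjI ballI allI impI)
  fix x y :: "'a kqel" assume "x \<in> kQ" "y \<in> kQ"
  show "kq_diff x y \<in> I \<Longrightarrow> kq_diff (theta_der (A, F) x) (theta_der (A, F) y) \<in> I"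
    by (rule theta_der_respects_I[OF assms \<open>x \<in> kQ\<close> \<open>y \<in> kQ\<close>])
  from \<open>x \<in> kQ\<close> \<open>y \<in> kQ\<close>
  show "kq_diff (theta_der (A, F) (kq_add x y)) (kq_add (theta_der (A, F) x) (theta_der (A, F) y)) \<in> I"
    and "kq_diff (theta_der (A, F) (kq_mult x y))
           (kq_add (kq_mult (theta_der (A, F) x) y) (kq_mult x (theta_der (A, F) y))) \<in> I"
    by (auto elim!: kQ_kq_elemE simp: theta_der_add theta_der_mult kq_diff_self zero_in_I)
next
  fix c and x :: "'a kqel" assume "x \<in> kQ"
  then show "kq_diff (theta_der (A, F) (kq_smult c x)) (kq_smult c (theta_der (A, F) x)) \<in> I"
    by (auto elim!: kQ_kq_elemE simp: theta_der_smult kq_diff_self zero_in_I)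
  show "theta_der (A, F) x \<in> kQ" by (simp add: theta_der_def)
qed

lemma theta_der_inner_imp_zero:
  assumes A: "poly_supp (fst \<Theta>) \<subseteq> {1..<m}" and F: "poly_supp (snd \<Theta>) \<subseteq> {..<n}"
    and inner: "is_lam_inner I (theta_der \<Theta>)"
  shows "\<Theta> = 0"
proof -
  obtain A F where \<Theta>: "\<Theta> = (A, F)" by fastforce
  obtain a where "a \<in> kQ"
    and inn: "\<And>x. x \<in> kQ \<Longrightarrow> kq_diff (theta_der \<Theta> x) (kq_diff (kq_mult a x) (kq_mult x a)) \<in> I"
    using inner unfolding is_lam_inner_def by blast
  obtain a1 a3 Ra Ma Pa Na where a: "a = kq_elem a1 a3 Ra Ma Pa Na"
    using \<open>a \<in> kQ\<close> by (rule kQ_kq_elemE)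
  have "monom 1 n dvd F"
    using inn[of "bpow 1"]
    by (simp add: \<Theta> a bpow_eq_kq_elem kq_elem_mult kq_elem_diff kq_elem_in_I_iff pderiv_monom)
  then have "coeff F j = 0" for j
    using F \<Theta> by (cases "j < n") (auto simp: monom_1_dvd_iff' poly_supp_def)
  then have "F = 0" by (simp add: poly_eq_iff)
  have "monom 1 n' dvd A - ([:a1:] - Ra)"
    using inn[of alpha] \<open>F = 0\<close>
    by (simp add: \<Theta> a alpha_eq_kq_elem kq_elem_mult kq_elem_diff kq_elem_in_I_iff)
  moreover have "monom 1 n'' dvd [:a3:] - Ra"
    using inn[of gamma] \<open>F = 0\<close>
    by (simp add: \<Theta> a gamma_eq_kq_elem kq_elem_mult kq_elem_diff kq_elem_in_I_iff)
  ultimately have "coeff A j = 0" if "j \<in> {1..<m}" for j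
    using that by (auto simp: monom_1_dvd_iff' coeff_pCons split: nat.splits)
  moreover have "coeff A j = 0" if "j \<notin> {1..<m}" for j
    using that A \<Theta> by (auto simp: poly_supp_def)
  ultimately have "A = 0" by (metis poly_eqI coeff_0)
  then show ?thesis using \<Theta> \<open>F = 0\<close> by (simp add: zero_prod_def)
qed

lemma hh1_dim_gt_if_independent_thetas:
  assumes indep: "independent_family smult_pair W {..N}"
    and W: "\<And>k. k \<le> N \<Longrightarrow> theta_stable V (W k) \<and> of_nat delta * coeff (snd (W k)) 0 = 0 \<and>
      poly_supp (fst (W k)) \<subseteq> {1..<m} \<and> poly_supp (snd (W k)) \<subseteq> {..<n}"
  shows "hh1_dim_gt I N"
proof -
  have "is_lam_der I (theta_der (W k))" if "k \<le> N" for k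
    using W[OF that] theta_der_is_lam_der[of "fst (W k)" "snd (W k)"] by simp
  moreover have "\<forall>k\<le>N. u k = 0" if "is_lam_inner I (\<lambda>x p. \<Sum>k\<le>N. u k * theta_der (W k) x p)" for u
  proof -
    let ?\<Theta> = "\<Sum>k\<le>N. smult_pair (u k) (W k)"
    have "is_lam_inner I (theta_der ?\<Theta>)" using that by (simp add: theta_der_lincomb)
    moreover have "poly_supp (fst ?\<Theta>) \<subseteq> {1..<m}" "poly_supp (snd ?\<Theta>) \<subseteq> {..<n}"
      using W poly_supp_lincomb[of u "\<lambda>k. fst (W k)" "{..N}"] poly_supp_lincomb[of u "\<lambda>k. snd (W k)" "{..N}"]
      by (force simp: fst_sum snd_sum)+
    ultimately have "?\<Theta> = 0" by (rule theta_der_inner_imp_zero[rotated 2])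
    then show ?thesis using indep by (auto intro: pair_vs.independent_familyD)
  qed
  ultimately show ?thesis unfolding hh1_dim_gt_def by (intro exI[of _ "\<lambda>k. theta_der (W k)"]) blast
qed

end

section \<open>Counting operators that stabilise V\<close>

text \<open>\<open>Ob\<close> is the set of pivot positions below \<open>k\<close> and \<open>vb b\<close> the reduced row with pivot \<open>b\<close>:
  the coefficients of an element of \<open>V\<close> at the pivots are free and determine its other
  coefficients below \<open>k\<close>.\<close>
definition echelon_basis :: "'a::field poly set \<Rightarrow> nat \<Rightarrow> nat set \<Rightarrow> (nat \<Rightarrow> 'a poly) \<Rightarrow> bool" where
  "echelon_basis V k Ob vb \<longleftrightarrow> Ob \<subseteq> {..<k} \<and> vb ` Ob \<subseteq> V \<and>
     (\<forall>b\<in>Ob. \<forall>b'\<in>Ob. coeff (vb b) b' = (if b = b' then 1 else 0)) \<and>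
     (\<forall>p\<in>V. \<forall>j<k. j \<notin> Ob \<longrightarrow> coeff p j = (\<Sum>b\<in>Ob. coeff p b * coeff (vb b) j))"

lemma echelon_basis_insert:
  assumes V: "poly_vs.subspace V" and ech: "echelon_basis V k Ob vb"
    and r: "r \<in> V" "coeff r k = 1" "\<And>b. b \<in> Ob \<Longrightarrow> coeff r b = 0"
      "\<And>j. j < k \<Longrightarrow> j \<notin> Ob \<Longrightarrow> coeff r j = 0"
  shows "echelon_basis V (Suc k) (insert k Ob)
    (\<lambda>b. if b = k then r else vb b - smult (coeff (vb b) k) r)"
    (is "echelon_basis V (Suc k) (insert k Ob) ?vb")
  unfolding echelon_basis_def
proof (intro conjI ballI allI impI)
  have Ob: "Ob \<subseteq> {..<k}" and vb: "vb ` Ob \<subseteq> V"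
    and pivot: "\<forall>b\<in>Ob. \<forall>b'\<in>Ob. coeff (vb b) b' = (if b = b' then 1 else 0)"
    and reduce: "\<forall>p\<in>V. \<forall>j<k. j \<notin> Ob \<longrightarrow> coeff p j = (\<Sum>b\<in>Ob. coeff p b * coeff (vb b) j)"
    using ech by (auto simp: echelon_basis_def)
  then have "finite Ob" "k \<notin> Ob" using finite_subset[OF Ob] by auto
  show "insert k Ob \<subseteq> {..<Suc k}" using Ob by auto
  show "?vb ` insert k Ob \<subseteq> V"
    using vb r(1) by (auto intro: poly_vs.subspace_diff[OF V] poly_vs.subspace_scale[OF V])
  show "coeff (?vb b) b' = (if b = b' then 1 else 0)" if "b \<in> insert k Ob" "b' \<in> insert k Ob" for b b'
    using that pivot r(2,3) \<open>k \<notin> Ob\<close> by auto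
  fix p j assume p: "p \<in> V" and "j < Suc k" "j \<notin> insert k Ob"
  then have j: "j < k" "j \<notin> Ob" by auto
  have "(\<Sum>b\<in>insert k Ob. coeff p b * coeff (?vb b) j)
      = coeff p k * coeff r j + (\<Sum>b\<in>Ob. coeff p b * coeff (?vb b) j)"
    using \<open>finite Ob\<close> \<open>k \<notin> Ob\<close> by simp
  also have "\<dots> = (\<Sum>b\<in>Ob. coeff p b * coeff (vb b) j)"
    using r(4)[OF j] \<open>k \<notin> Ob\<close> by (simp, intro sum.cong) auto
  also have "\<dots> = coeff p j" using reduce p j by simp
  finally show "coeff p j = (\<Sum>b\<in>insert k Ob. coeff p b * coeff (?vb b) j)" by simp
qed

lemma echelon_basis_Suc:
  assumes V: "poly_vs.subspace V" and ech: "echelon_basis V k Ob vb"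
  shows "\<exists>Ob' vb'. echelon_basis V (Suc k) Ob' vb'"
proof (cases "\<forall>p\<in>V. coeff p k = (\<Sum>b\<in>Ob. coeff p b * coeff (vb b) k)")
  case True
  then have "echelon_basis V (Suc k) Ob vb"
    using ech by (auto simp: echelon_basis_def less_Suc_eq)
  then show ?thesis by blast
next
  case False
  have vb: "vb ` Ob \<subseteq> V"
    and pivot: "\<forall>b\<in>Ob. \<forall>b'\<in>Ob. coeff (vb b) b' = (if b = b' then 1 else 0)"
    and reduce: "\<forall>p\<in>V. \<forall>j<k. j \<notin> Ob \<longrightarrow> coeff p j = (\<Sum>b\<in>Ob. coeff p b * coeff (vb b) j)"
    using ech by (auto simp: echelon_basis_def)
  have "finite Ob" using ech finite_subset[of Ob "{..<k}"] by (auto simp: echelon_basis_def)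
  from False obtain p0 where p0: "p0 \<in> V" "coeff p0 k \<noteq> (\<Sum>b\<in>Ob. coeff p0 b * coeff (vb b) k)"
    by blast
  define r0 where "r0 = p0 - (\<Sum>b\<in>Ob. smult (coeff p0 b) (vb b))"
  define r where "r = smult (inverse (coeff r0 k)) r0"
  have coeff_r0: "coeff r0 j = coeff p0 j - (\<Sum>b\<in>Ob. coeff p0 b * coeff (vb b) j)" for j
    by (simp add: r0_def coeff_sum)
  have "r0 \<in> V" unfolding r0_def using p0(1) vb
    by (intro poly_vs.subspace_diff[OF V] poly_vs.subspace_sum[OF V] poly_vs.subspace_scale[OF V]) auto
  then have "r \<in> V" unfolding r_def by (rule poly_vs.subspace_scale[OF V])
  moreover have "coeff r k = 1" using p0(2) by (simp add: r_def coeff_r0)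
  moreover have "coeff r b' = 0" if "b' \<in> Ob" for b'
  proof -
    have "(\<Sum>b\<in>Ob. coeff p0 b * coeff (vb b) b') = (\<Sum>b\<in>Ob. if b = b' then coeff p0 b else 0)"
      using that pivot by (intro sum.cong) auto
    then show ?thesis using that \<open>finite Ob\<close> by (simp add: r_def coeff_r0)
  qed
  moreover have "coeff r j = 0" if "j < k" "j \<notin> Ob" for j
    using reduce p0(1) that by (simp add: r_def coeff_r0)
  ultimately show ?thesis using echelon_basis_insert[OF V ech] by blast
qed

lemma echelon_basis_exists:
  assumes "poly_vs.subspace V"
  shows "\<exists>Ob vb. echelon_basis V k Ob vb"
proof (induction k)
  case 0
  show ?case by (rule exI[of _ "{}"]) (simp add: echelon_basis_def)
next
  case (Suc k)
  then show ?case using echelon_basis_Suc[OF assms] by blast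
qed

locale echelon_data = quiver_ideal n n' n'' V
  for n n' n'' :: nat and V :: "'a::field poly set" +
  fixes Ob :: "nat set" and vb :: "nat \<Rightarrow> 'a poly"
  assumes echelon: "echelon_basis V (min n' n'') Ob vb"
begin

lemma Ob_subset: "Ob \<subseteq> {..<m}" and vb_in_V: "b \<in> Ob \<Longrightarrow> vb b \<in> V"
  and coeff_vb: "b \<in> Ob \<Longrightarrow> b' \<in> Ob \<Longrightarrow> coeff (vb b) b' = (if b = b' then 1 else 0)"
  and coeff_reduce: "p \<in> V \<Longrightarrow> j < m \<Longrightarrow> j \<notin> Ob \<Longrightarrow> coeff p j = (\<Sum>b\<in>Ob. coeff p b * coeff (vb b) j)"
  using echelon by (auto simp: echelon_basis_def)

lemma finite_Ob: "finite Ob"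
  using Ob_subset finite_subset by blast

lemma card_Ob_le: "card Ob \<le> m"
  using card_mono[OF _ Ob_subset] by simp

definition pivot_defect :: "nat \<Rightarrow> 'a poly \<Rightarrow> 'a" where
  "pivot_defect j p = coeff p j - (\<Sum>b\<in>Ob. coeff p b * coeff (vb b) j)"

lemma coeff_pivot_comb: "b' \<in> Ob \<Longrightarrow> coeff (\<Sum>b\<in>Ob. smult (u b) (vb b)) b' = u b'"
  using finite_Ob by (simp add: coeff_sum coeff_vb if_distrib[of "\<lambda>x. _ * x"] cong: if_cong)

lemma pivot_comb_in_V: "(\<Sum>b\<in>Ob. smult (u b) (vb b)) \<in> V"
  using vb_in_V by (intro poly_vs.subspace_sum[OF subspace_V] poly_vs.subspace_scale[OF subspace_V])

lemma monom_dvd_sub_pivot_comb: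
  assumes "\<forall>j<m. j \<notin> Ob \<longrightarrow> pivot_defect j p = 0"
  shows "monom 1 m dvd p - (\<Sum>b\<in>Ob. smult (coeff p b) (vb b))"
proof -
  have "coeff (p - (\<Sum>b\<in>Ob. smult (coeff p b) (vb b))) j = 0" if "j < m" for j
  proof (cases "j \<in> Ob")
    case True
    then show ?thesis by (simp add: coeff_pivot_comb)
  next
    case False
    then show ?thesis using assms that by (simp add: pivot_defect_def coeff_sum)
  qed
  then show ?thesis by (simp add: monom_1_dvd_iff')
qed

lemma in_V_iff_pivot_defects:
  "p \<in> V \<longleftrightarrow> (\<forall>j<m. j \<notin> Ob \<longrightarrow> pivot_defect j p = 0)"
proof
  assume "p \<in> V"
  then show "\<forall>j<m. j \<notin> Ob \<longrightarrow> pivot_defect j p = 0" by (simp add: pivot_defect_def coeff_reduce)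
next
  assume "\<forall>j<m. j \<notin> Ob \<longrightarrow> pivot_defect j p = 0"
  then have "p - (\<Sum>b\<in>Ob. smult (coeff p b) (vb b)) \<in> V"
    by (intro monom_dvd_in_V monom_dvd_sub_pivot_comb)
  then have "p - (\<Sum>b\<in>Ob. smult (coeff p b) (vb b)) + (\<Sum>b\<in>Ob. smult (coeff p b) (vb b)) \<in> V"
    using pivot_comb_in_V by (intro poly_vs.subspace_add[OF subspace_V])
  then show "p \<in> V" by simp
qed

text \<open>Stability of \<open>V\<close> needs to be checked on the reduced rows only, since \<open>\<Theta>\<close> preserves
  \<open>(\<beta>\<^sup>m) \<subseteq> V\<close>.\<close>
lemma theta_stable_if_stable_on_rows:
  assumes F0: "of_nat m * coeff (snd \<Theta>) 0 = 0"
    and rows: "\<And>b. b \<in> Ob \<Longrightarrow> fst \<Theta> * vb b + snd \<Theta> * pderiv (vb b) \<in> V"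
  shows "theta_stable V \<Theta>"
  unfolding theta_stable_def
proof
  fix v assume "v \<in> V"
  obtain A F where \<Theta>: "\<Theta> = (A, F)" by fastforce
  define s where "s = (\<Sum>b\<in>Ob. smult (coeff v b) (vb b))"
  define q where "q = v - s"
  have "monom 1 m dvd q"
    unfolding q_def s_def using \<open>v \<in> V\<close> in_V_iff_pivot_defects by (blast intro: monom_dvd_sub_pivot_comb)
  then have "A * q + F * pderiv q \<in> V"
    using F0 \<Theta> by (intro monom_dvd_in_V dvd_add dvd_mult monom_1_dvd_mult_pderiv) auto
  moreover have "A * s + F * pderiv s = (\<Sum>b\<in>Ob. smult (coeff v b) (A * vb b + F * pderiv (vb b)))"
    unfolding s_def by (simp add: higher_pderiv_sum[where n = 1, simplified] pderiv_smult sum_distrib_left sum.distrib smult_add_right)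
  moreover have "(\<Sum>b\<in>Ob. smult (coeff v b) (A * vb b + F * pderiv (vb b))) \<in> V"
    using rows \<Theta> by (intro poly_vs.subspace_sum[OF subspace_V] poly_vs.subspace_scale[OF subspace_V]) auto
  ultimately have "(A * q + F * pderiv q) + (A * s + F * pderiv s) \<in> V"
    using poly_vs.subspace_add[OF subspace_V] by metis
  then show "fst \<Theta> * v + snd \<Theta> * pderiv v \<in> V"
    by (simp add: \<Theta> q_def pderiv_diff algebra_simps)
qed

lemma indep_mod_card_Ob: "indep_mod V m (card Ob)"
proof -
  let ?bs = "sorted_list_of_set Ob"
  have "cs ! i = 0"
    if "monom 1 m dvd (\<Sum>l<card Ob. smult (cs ! l) (map vb ?bs ! l))" and "i < card Ob"
    for cs :: "'a list" and i
  proof -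
    have "?bs ! i \<in> Ob" using \<open>i < card Ob\<close> finite_Ob by (metis length_sorted_list_of_set nth_mem set_sorted_list_of_set)
    have "coeff (\<Sum>l<card Ob. smult (cs ! l) (map vb ?bs ! l)) (?bs ! i)
        = (\<Sum>l<card Ob. if l = i then cs ! l else 0)"
      unfolding coeff_sum
    proof (intro sum.cong refl)
      fix l assume "l \<in> {..<card Ob}"
      then have "?bs ! l \<in> Ob" using finite_Ob by (metis lessThan_iff length_sorted_list_of_set nth_mem set_sorted_list_of_set)
      moreover have "?bs ! l = ?bs ! i \<longleftrightarrow> l = i"
        using \<open>l \<in> {..<card Ob}\<close> \<open>i < card Ob\<close> by (simp add: nth_eq_iff_index_eq)
      ultimately show "coeff (smult (cs ! l) (map vb ?bs ! l)) (?bs ! i) = (if l = i then cs ! l else 0)"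
        using \<open>l \<in> {..<card Ob}\<close> \<open>?bs ! i \<in> Ob\<close> by (simp add: coeff_vb)
    qed
    also have "\<dots> = cs ! i" using \<open>i < card Ob\<close> by simp
    finally show ?thesis
      using that(1) \<open>?bs ! i \<in> Ob\<close> Ob_subset by (auto simp: monom_1_dvd_iff')
  qed
  moreover have "set (map vb ?bs) \<subseteq> V" using vb_in_V finite_Ob by auto
  ultimately show ?thesis unfolding indep_mod_def by (intro exI[of _ "map vb ?bs"]) auto
qed

lemma indep_mod_le_card_Ob:
  assumes "indep_mod V m r"
  shows "r \<le> card Ob"
proof (rule ccontr)
  assume "\<not> r \<le> card Ob"
  obtain ps where "length ps = r" "set ps \<subseteq> V"
    and indep: "\<And>cs. length cs = r \<Longrightarrow> monom 1 m dvd (\<Sum>i<r. smult (cs ! i) (ps ! i)) \<Longrightarrow> \<forall>i<r. cs ! i = 0"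
    using assms unfolding indep_mod_def by blast
  define comb where "comb u = (\<Sum>i<r. smult (coeff u i) (ps ! i))" for u
  define Ls where "Ls = (\<lambda>b u. coeff (comb u) b) ` Ob"
  have "finite Ls" "card Ls \<le> card Ob"
    using finite_Ob by (simp_all add: Ls_def card_image_le)
  have "Vector_Spaces.linear smult (*) (\<lambda>u. coeff (comb u) b)" for b
    by (rule poly_vs.linear_functionalI)
      (simp_all add: comb_def coeff_sum distrib_right sum.distrib sum_distrib_left mult.assoc)
  then have "\<forall>L\<in>Ls. Vector_Spaces.linear smult (*) L" by (simp add: Ls_def)
  moreover have "monom 1 ` {..<r} \<subseteq> {u. poly_supp u \<subseteq> {..<r}}"
    by (auto simp: poly_supp_def coeff_monom split: if_splits)
  moreover have "card Ls < card {..<r}"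
    using \<open>card Ls \<le> card Ob\<close> \<open>\<not> r \<le> card Ob\<close> by simp
  ultimately obtain u where u: "poly_supp u \<subseteq> {..<r}" "u \<noteq> 0" "\<forall>L\<in>Ls. L u = 0"
    using poly_vs.nonzero_in_kernels[OF \<open>finite Ls\<close> _ independent_family_monom subspace_poly_supp]
    by (metis finite_lessThan mem_Collect_eq)
  have "comb u \<in> V"
    unfolding comb_def using \<open>set ps \<subseteq> V\<close> \<open>length ps = r\<close>
    by (intro poly_vs.subspace_sum[OF subspace_V] poly_vs.subspace_scale[OF subspace_V]) auto
  moreover have "coeff (comb u) b = 0" if "b \<in> Ob" for b
    using u(3) that by (auto simp: Ls_def)
  ultimately have "coeff (comb u) j = 0" if "j < m" for j
    using that by (cases "j \<in> Ob") (simp_all add: coeff_reduce)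
  then have "monom 1 m dvd comb u" by (simp add: monom_1_dvd_iff')
  then have "coeff u i = 0" if "i < r" for i
    using indep[of "map (coeff u) [0..<r]"] that by (simp add: comb_def)
  moreover have "coeff u i = 0" if "\<not> i < r" for i
    using u(1) that by (auto simp: poly_supp_def)
  ultimately have "u = 0" by (metis poly_eqI coeff_0)
  then show False using u(2) by simp
qed

lemma quot_dim_eq_card_Ob: "quot_dim V m = card Ob"
  unfolding quot_dim_def
  using indep_mod_card_Ob indep_mod_le_card_Ob by (rule Greatest_equality)

lemma pivot_defect_add: "pivot_defect j (p + q) = pivot_defect j p + pivot_defect j q"
  by (simp add: pivot_defect_def sum.distrib algebra_simps)

lemma pivot_defect_smult: "pivot_defect j (smult c p) = c * pivot_defect j p"
  by (simp add: pivot_defect_def sum_distrib_left algebra_simps)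

lemma linear_pivot_defect_form:
  "Vector_Spaces.linear smult_pair (*) (\<lambda>\<Theta>. pivot_defect j (fst \<Theta> * vb b + snd \<Theta> * pderiv (vb b)))"
  by (rule pair_vs.linear_functionalI)
    (simp_all add: pivot_defect_add pivot_defect_smult distrib_right flip: smult_add_right)

lemma theta_stable_if_defects_vanish:
  assumes "of_nat m * coeff (snd \<Theta>) 0 = 0"
    and "\<And>b j. b \<in> Ob \<Longrightarrow> j < m \<Longrightarrow> j \<notin> Ob \<Longrightarrow>
      pivot_defect j (fst \<Theta> * vb b + snd \<Theta> * pderiv (vb b)) = 0"
  shows "theta_stable V \<Theta>"
  using assms by (intro theta_stable_if_stable_on_rows) (auto simp: in_V_iff_pivot_defects)

text \<open>The operators with \<open>A \<in> span(\<beta>, \<dots>, \<beta>\<^sup>m\<^sup>-\<^sup>1)\<close> and \<open>F \<in> span(\<beta>\<^sup>1\<^sup>-\<^sup>c, \<dots>, \<beta>\<^sup>m\<^sup>-\<^sup>1)\<close>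
  form a space of dimension \<open>2m - 2 + c\<close>; stability of \<open>V\<close> amounts to the vanishing of the
  \<open>d(m - d)\<close> linear forms \<open>\<Theta> \<mapsto> pivot_defect j (\<Theta> (vb b))\<close>.\<close>
lemma stable_thetas_exist:
  assumes c: "c \<le> 1" "c = 1 \<Longrightarrow> of_nat delta = (0::'a)"
    and count: "card Ob * (m - card Ob) + 3 \<le> 2 * m"
  obtains W where "independent_family smult_pair W {..c}"
    and "\<forall>k\<le>c. theta_stable V (W k) \<and>
      poly_supp (fst (W k)) \<subseteq> {1..<m} \<and> poly_supp (snd (W k)) \<subseteq> {1 - c..<m}"
proof -
  let ?S = "{\<Theta> :: 'a poly \<times> 'a poly. poly_supp (fst \<Theta>) \<subseteq> {1..<m} \<and> poly_supp (snd \<Theta>) \<subseteq> {1 - c..<m}}"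
  let ?I = "Inl ` {1..<m} \<union> Inr ` {1 - c..<m}"
  let ?L = "\<lambda>(b, j) \<Theta>. pivot_defect j (fst \<Theta> * vb b + snd \<Theta> * pderiv (vb b))"
  define Ls where "Ls = ?L ` (Ob \<times> ({..<m} - Ob))"
  have "finite Ls" using finite_Ob by (simp add: Ls_def)
  have "card Ls \<le> card Ob * (m - card Ob)"
    using card_image_le[of "Ob \<times> ({..<m} - Ob)" ?L] finite_Ob Ob_subset
    by (simp add: Ls_def card_cartesian_product card_Diff_subset)
  have lin: "\<forall>L\<in>Ls. Vector_Spaces.linear smult_pair (*) L"
    using linear_pivot_defect_form by (auto simp: Ls_def)
  have basis: "case_sum (\<lambda>j. (monom 1 j, 0)) (\<lambda>j. (0, monom 1 j)) ` ?I \<subseteq> ?S"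
    by (auto simp: poly_supp_monom)
  have "card ?I = (m - 1) + (m - (1 - c))"
    by (subst card_Un_disjoint) (auto simp: card_image)
  then have card: "Suc c + card Ls \<le> card ?I"
    using count c(1) \<open>card Ls \<le> card Ob * (m - card Ob)\<close> by linarith
  obtain W where indep: "independent_family smult_pair W {..<Suc c}"
    and W: "W ` {..<Suc c} \<subseteq> ?S \<inter> {\<Theta>. \<forall>L\<in>Ls. L \<Theta> = 0}"
    by (rule pair_vs.independent_family_in_kernels[OF \<open>finite Ls\<close> _
          independent_family_monom_pairs[OF finite_atLeastLessThan finite_atLeastLessThan]
          subspace_pair_poly_supp basis lin card]) simp
  have Wk: "W k \<in> ?S" "\<forall>L\<in>Ls. L (W k) = 0" if "k \<le> c" for k
  proof -
    have "k \<in> {..<Suc c}" using that by simp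
    then show "W k \<in> ?S" "\<forall>L\<in>Ls. L (W k) = 0" using W by blast+
  qed
  have "theta_stable V (W k)" if k: "k \<le> c" for k
  proof (rule theta_stable_if_defects_vanish)
    have "poly_supp (snd (W k)) \<subseteq> {1 - c..<m}" using Wk(1)[OF k] by simp
    then have "c = 0 \<Longrightarrow> coeff (snd (W k)) 0 = 0" by (auto simp: poly_supp_def)
    then show "of_nat m * coeff (snd (W k)) 0 = 0"
      using c of_nat_mult_eq_0_dvd[OF _ delta_dvd(4), of "coeff (snd (W k)) 0"] by (cases c) auto
    show "pivot_defect j (fst (W k) * vb b + snd (W k) * pderiv (vb b)) = 0"
      if "b \<in> Ob" "j < m" "j \<notin> Ob" for b j
      using Wk(2)[OF k] that by (auto simp: Ls_def)
  qed
  moreover have "{..<Suc c} = {..c}" by auto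
  ultimately show ?thesis using that[of W] indep Wk(1) by simp
qed

lemma Dprime_nonzero_if_count_bound:
  assumes count: "card Ob * (m - card Ob) + 3 \<le> 2 * m"
  shows "Dprime_nonzero V m"
proof -
  have "(0::nat) = 1 \<Longrightarrow> of_nat delta = (0::'a)" by simp
  then obtain W where indep: "independent_family smult_pair W {..0::nat}"
    and W: "\<forall>k\<le>0. theta_stable V (W k) \<and>
      poly_supp (fst (W k)) \<subseteq> {1..<m} \<and> poly_supp (snd (W k)) \<subseteq> {1 - 0..<m}"
    by (rule stable_thetas_exist[OF le0 _ count]) blast
  have "W 0 \<noteq> 0" using indep by (rule pair_vs.independent_family_nonzero) simp_all
  then show ?thesis using W by (intro Dprime_nonzero_if_stable_theta[of V "W 0"]) simp_all
qed

lemma hh1_dim_gt_if_count_bound: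
  assumes c: "c \<le> 1" "c = 1 \<Longrightarrow> of_nat delta = (0::'a)"
    and count: "card Ob * (m - card Ob) + 3 \<le> 2 * m"
  shows "hh1_dim_gt I (n - m + c)"
proof -
  obtain W where indep: "independent_family smult_pair W {..c}"
    and W: "\<forall>k\<le>c. theta_stable V (W k) \<and>
      poly_supp (fst (W k)) \<subseteq> {1..<m} \<and> poly_supp (snd (W k)) \<subseteq> {1 - c..<m}"
    using stable_thetas_exist[OF c count] by blast
  have "m \<le> n" using n'_le_n by simp
  have "m \<ge> 1" using count by (cases m) auto
  define W' where "W' k = (if k \<le> c then W k else (0, monom 1 (m + k - Suc c)))" for k
  have "independent_family smult_pair W' {..n - m + c}"
    unfolding W'_def using W by (intro independent_family_extend_monoms[OF indep]) (force simp: subset_iff)+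
  moreover have "theta_stable V (W' k) \<and> of_nat delta * coeff (snd (W' k)) 0 = 0 \<and>
      poly_supp (fst (W' k)) \<subseteq> {1..<m} \<and> poly_supp (snd (W' k)) \<subseteq> {..<n}"
    if "k \<le> n - m + c" for k
  proof (cases "k \<le> c")
    case True
    then have "theta_stable V (W k)" "poly_supp (fst (W k)) \<subseteq> {1..<m}"
      and supp: "poly_supp (snd (W k)) \<subseteq> {1 - c..<m}"
      using W by auto
    moreover have "of_nat delta * coeff (snd (W k)) 0 = 0"
      using c supp by (cases c) (auto simp: poly_supp_def)
    moreover have "{1 - c..<m} \<subseteq> {..<n}" using \<open>m \<le> n\<close> by auto
    ultimately show ?thesis using True by (auto simp: W'_def)
  next
    case False
    let ?j = "m + k - Suc c"
    have "monom 1 ?j = monom 1 m * (monom 1 (?j - m) :: 'a poly)"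
      using False by (simp add: mult_monom)
    then have "monom 1 m dvd monom 1 ?j * pderiv v" for v :: "'a poly"
      by (simp add: mult.assoc)
    then have "theta_stable V (0, monom 1 ?j)"
      by (simp add: theta_stable_def monom_dvd_in_V)
    moreover have "?j \<noteq> 0" "?j < n" using False that \<open>m \<ge> 1\<close> \<open>m \<le> n\<close> by auto
    ultimately show ?thesis using False by (simp add: W'_def poly_supp_monom)
  qed
  ultimately show ?thesis by (rule hh1_dim_gt_if_independent_thetas)
qed

end

lemma count_bound_if_dim_condition:
  fixes d m :: nat
  assumes "d \<le> m" and "(d \<le> 2 \<and> 2 \<le> m) \<or> (d > 2 \<and> real d + 2 / (real d - 2) > real m - 2)"
  shows "d * (m - d) + 3 \<le> 2 * m"
  using assms(2)
proof
  assume "d \<le> 2 \<and> 2 \<le> m"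
  then have "d = 0 \<or> d = 1 \<or> d = 2" by auto
  then show ?thesis using \<open>d \<le> 2 \<and> 2 \<le> m\<close> by (auto simp: algebra_simps)
next
  assume a: "d > 2 \<and> real d + 2 / (real d - 2) > real m - 2"
  then have d2: "real d - 2 > 0" by simp
  have "(real m - 2) * (real d - 2) < (real d + 2 / (real d - 2)) * (real d - 2)"
    using a d2 by (intro mult_strict_right_mono) auto
  also have "\<dots> = real d * (real d - 2) + 2" using d2 by (simp add: field_simps)
  finally have "real d * real m - real d * real d < 2 * real m - 2"
    by (simp add: algebra_simps)
  moreover have "real (d * (m - d)) = real d * real m - real d * real d"
    using assms(1) by (simp add: of_nat_diff algebra_simps)
  ultimately have "real (d * (m - d)) < real (2 * m - 2)"
    using a assms(1) by (simp add: of_nat_diff)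
  then have "d * (m - d) < 2 * m - 2" by (simp only: of_nat_less_iff)
  then show ?thesis using a assms(1) by simp
qed

theorem mainTheorem10:
  fixes V :: "('a::field) poly set" and n n' n'' :: nat
  defines "m \<equiv> min n' n''"
  defines "d \<equiv> quot_dim V m"
  defines "c \<equiv> (if of_nat (gcd n (gcd n' n'')) = (0::'a) then 1 else 0 :: nat)"
  assumes "2 \<le> n" and "1 \<le> n'" and "n' \<le> n" and "1 \<le> n''" and "n'' \<le> n"
    and "poly_subspace V" and "\<forall>p. monom 1 m dvd p \<longrightarrow> p \<in> V"
    and "(d \<le> 2 \<and> 2 \<le> m) \<or> (d > 2 \<and> real d + 2 / (real d - 2) > real m - 2)"
  shows "Dprime_nonzero V m \<and> hh1_dim_gt (I_ideal n n' n'' V) (n - m + c)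
         \<and> hh1_nonzero (I_ideal n n' n'' V)"
proof -
  interpret quiver_ideal n n' n'' V
    using assms(6,8-10) by unfold_locales (simp_all add: m_def)
  obtain Ob vb where "echelon_basis V (min n' n'') Ob vb"
    using echelon_basis_exists[OF subspace_V] by blast
  then interpret echelon_data n n' n'' V Ob vb
    by unfold_locales
  have "d = card Ob"
    using quot_dim_eq_card_Ob by (simp add: d_def m_def)
  then have count: "card Ob * (min n' n'' - card Ob) + 3 \<le> 2 * min n' n''"
    using count_bound_if_dim_condition[OF card_Ob_le] assms(11) by (simp add: m_def)
  have "c \<le> 1" "c = 1 \<Longrightarrow> of_nat (gcd n (gcd n' n'')) = (0::'a)"
    by (simp_all add: c_def split: if_splits)
  then have "hh1_dim_gt (I_ideal n n' n'' V) (n - m + c)"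
    using hh1_dim_gt_if_count_bound count by (simp add: m_def)
  then show ?thesis
    using Dprime_nonzero_if_count_bound[OF count] hh1_dim_gt_imp_nonzero by (simp add: m_def)
qed

end
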